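(* Let $d\ge0$ and $k\ge1$ be integers with $k\le 2^d$. Then there exists a minimum-entropy Markovian avoidance coupling for $k$ walkers on $K_n^*$ for $n=2^{d+1}$ and for $n=2^{d+1}+1$, as well as on $K_n$ for $n=2^{d+1}+1$.
   Context: $K_n$ is the loopless complete graph on $n$ vertices; a random walk on it moves at each step to a uniformly random vertex other than its current one. $K_n^*$ is the complete graph on $n$ vertices with a single self-loop at each vertex; a random walk on it moves at each step to a uniformly random vertex among all $n$ (so it stays in place with probability $1/n$). Walkers $1,\dots,k$ take turns to move in discrete time in the fixed cyclic order $X^{(1)}_0,\dots,X^{(k)}_0,X^{(1)}_1,\dots,X^{(k)}_1,\dots$. A coupling is a realization of all the walks on a common probability space such that each $(X^{(j)}_t)_{t\ge0}$, viewed separately, is a random walk on the graph (the initial states may be coupled in an arbitrary way). A collision occurs exactly if a walker moves to a vertex currently occupied by another; i.e. the collisions are the events $X^{(i)}_t=X^{(j)}_t$ for $i\ne j$ and $X^{(i)}_{t+1}=X^{(j)}_t$ for $i<j$ ($t\ge 0$). An avoidance coupling is a coupling in which (almost surely) no collision ever occurs. A coupling is Markovian if it is itself a time-homogeneous Markov chain: given the whole past, the conditional law of each move depends only on the current locations of all the walkers and on whose turn it is to move. A coupling has minimum entropy if the entropy of the coupling equals the entropy of a single walker; here entropy is understood as entropy rate per round, i.e. $\lim_{T\to\infty}\frac1T H\big((X^{(j)}_t)_{1\le j\le k,\,0\le t\le T}\big)=\lim_{T\to\infty}\frac1T H\big((X^{(1)}_t)_{0\le t\le T}\big)$, where $H$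 is Shannon entropy. *)

theory Defs
  imports "HOL-Probability.Probability"
begin

text \<open>
  A graph is given by a finite vertex set \<open>V\<close> and a symmetric edge relation \<open>E \<subseteq> V \<times> V\<close>; a
  self-loop is a pair \<open>(v, v)\<close> and counts once, so the neighbours of \<open>v\<close> are \<open>E `` {v}\<close>.
\<close>

definition complete_verts :: "nat \<Rightarrow> nat set" where
  "complete_verts n = {..<n}"

definition complete_edges :: "nat \<Rightarrow> (nat \<times> nat) set" where
  "complete_edges n = {(u, v). u < n \<and> v < n \<and> u \<noteq> v}"

definition complete_loop_edges :: "nat \<Rightarrow> (nat \<times> nat) set" where
  "complete_loop_edges n = {(u, v). u < n \<and> v < n}"

text \<open>
  Conditional laws are elementary: since the vertex set is finite, it suffices to condition on
  the histories of positive probability. The law of the initial state is arbitrary.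
\<close>

definition random_walk ::
  "'a measure \<Rightarrow> 'v set \<Rightarrow> ('v \<times> 'v) set \<Rightarrow> (nat \<Rightarrow> 'a \<Rightarrow> 'v) \<Rightarrow> bool" where
  "random_walk M V E X \<longleftrightarrow>
     prob_space M \<and>
     (\<forall>t. X t \<in> measurable M (count_space V)) \<and>
     (\<forall>t x v. \<P>(\<omega> in M. \<forall>s\<le>t. X s \<omega> = x s) > 0 \<longrightarrow>
        \<P>(\<omega> in M. X (Suc t) \<omega> = v \<bar> \<forall>s\<le>t. X s \<omega> = x s)
          = (if v \<in> E `` {x t} then 1 / real (card (E `` {x t})) else 0))"

text \<open>
  The walkers are \<open>0, \<dots>, k - 1\<close>, and \<open>X j t\<close> is the position of walker \<open>j\<close> after its \<open>t\<close>-th move;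
  only the indices \<open>j < k\<close> matter.
\<close>

definition coupling ::
  "'a measure \<Rightarrow> 'v set \<Rightarrow> ('v \<times> 'v) set \<Rightarrow> nat \<Rightarrow> (nat \<Rightarrow> nat \<Rightarrow> 'a \<Rightarrow> 'v) \<Rightarrow> bool" where
  "coupling M V E k X \<longleftrightarrow> prob_space M \<and> (\<forall>j<k. random_walk M V E (X j))"

definition avoidance_coupling ::
  "'a measure \<Rightarrow> 'v set \<Rightarrow> ('v \<times> 'v) set \<Rightarrow> nat \<Rightarrow> (nat \<Rightarrow> nat \<Rightarrow> 'a \<Rightarrow> 'v) \<Rightarrow> bool" where
  "avoidance_coupling M V E k X \<longleftrightarrow>
     coupling M V E k X \<and>
     (AE \<omega> in M. \<forall>t. \<forall>i<k. \<forall>j<k.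
        (i \<noteq> j \<longrightarrow> X i t \<omega> \<noteq> X j t \<omega>) \<and> (i < j \<longrightarrow> X i (Suc t) \<omega> \<noteq> X j t \<omega>))"

text \<open>
  When walker \<open>j\<close> is about to make its move number \<open>Suc t\<close>, exactly the walkers \<open>i < j\<close> have
  already made theirs.
\<close>

definition last_time :: "nat \<Rightarrow> nat \<Rightarrow> nat \<Rightarrow> nat" where
  "last_time j t i = (if i < j then Suc t else t)"

definition same_past ::
  "nat \<Rightarrow> nat \<Rightarrow> nat \<Rightarrow> (nat \<Rightarrow> nat \<Rightarrow> 'v) \<Rightarrow> (nat \<Rightarrow> nat \<Rightarrow> 'v) \<Rightarrow> bool" where
  "same_past k j t y x \<longleftrightarrow> (\<forall>i<k. \<forall>s\<le>last_time j t i. y i s = x i s)"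

definition current_locations ::
  "nat \<Rightarrow> nat \<Rightarrow> nat \<Rightarrow> (nat \<Rightarrow> nat \<Rightarrow> 'v) \<Rightarrow> nat \<Rightarrow> 'v" where
  "current_locations k j t x = (\<lambda>i\<in>{..<k}. x i (last_time j t i))"

text \<open>
  The kernel \<open>K\<close> depends on whose turn it is and on the locations, but not on \<open>t\<close>.
\<close>

definition markovian ::
  "'a measure \<Rightarrow> nat \<Rightarrow> (nat \<Rightarrow> nat \<Rightarrow> 'a \<Rightarrow> 'v) \<Rightarrow> bool" where
  "markovian M k X \<longleftrightarrow>
     (\<exists>K :: nat \<Rightarrow> (nat \<Rightarrow> 'v) \<Rightarrow> 'v pmf. \<forall>j<k. \<forall>t x v.
        \<P>(\<omega> in M. same_past k j t (\<lambda>i s. X i s \<omega>) x) > 0 \<longrightarrow>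
        \<P>(\<omega> in M. X j (Suc t) \<omega> = v \<bar> same_past k j t (\<lambda>i s. X i s \<omega>) x)
          = pmf (K j (current_locations k j t x)) v)"

text \<open>
  Shannon entropy (in bits) of a random variable with finite range, and entropy rate per round.
\<close>

definition shannon_entropy :: "'a measure \<Rightarrow> ('a \<Rightarrow> 'b) \<Rightarrow> real" where
  "shannon_entropy M Y = prob_space.entropy M 2 (count_space (Y ` space M)) Y"

definition has_entropy_rate :: "'a measure \<Rightarrow> nat set \<Rightarrow> (nat \<Rightarrow> nat \<Rightarrow> 'a \<Rightarrow> 'v) \<Rightarrow> real \<Rightarrow> bool" where
  "has_entropy_rate M J X h \<longleftrightarrow>
     (\<lambda>T. shannon_entropy M (\<lambda>\<omega>. \<lambda>(j, t)\<in>J \<times> {..T}. X j t \<omega>) / real T) \<longlonglongrightarrow> h"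

definition minimum_entropy :: "'a measure \<Rightarrow> nat \<Rightarrow> (nat \<Rightarrow> nat \<Rightarrow> 'a \<Rightarrow> 'v) \<Rightarrow> bool" where
  "minimum_entropy M k X \<longleftrightarrow>
     (\<exists>h. has_entropy_rate M {..<k} X h \<and> has_entropy_rate M {0} X h)"

text \<open>
  Existence is stated over probability spaces on sequences of naturals. This is no restriction
  for vertices in \<open>nat\<close> and \<open>k \<ge> 1\<close>: the joint law of a coupling can be realized on the space of
  its interleaved trajectories \<open>t * k + j \<mapsto> X j t\<close>.
\<close>

definition exists_min_entropy_markovian_avoidance_coupling ::
  "nat set \<Rightarrow> (nat \<times> nat) set \<Rightarrow> nat \<Rightarrow> bool" where
  "exists_min_entropy_markovian_avoidance_coupling V E k \<longleftrightarrow>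
     (\<exists>(M :: (nat \<Rightarrow> nat) measure) X.
        avoidance_coupling M V E k X \<and> markovian M k X \<and> minimum_entropy M k X)"

end

theory Submission
  imports Defs "HOL-Library.Discrete_Functions"
begin

text \<open>
  Locations are taken modulo \<open>n\<close>. Let \<open>m = 2 ^ (d + 1)\<close>, let \<open>e\<close> be least with \<open>k \<le> 2 ^ e\<close>, and read a
  number \<open>\<epsilon> < 2 ^ e\<close> as a row of \<open>e\<close> signs, digit \<open>1\<close> meaning plus. For \<open>j < 2 ^ e\<close> let \<open>spin \<epsilon> j\<close> be the
  sum of \<open>\<plusminus>2 ^ b\<close> over the binary digits \<open>b\<close> of \<open>j\<close>, with the signs of \<open>\<epsilon>\<close>. Between two rounds the
  walkers stand in the formation \<open>x + spin \<epsilon> j\<close>, so walker \<open>0\<close> is at \<open>x\<close>. In a round walker \<open>0\<close> moves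
  to \<open>x + 1 + c\<close>, where the digits \<open>1, \<dots>, e\<close> of \<open>c < m\<close> are the signs \<open>\<epsilon>\<close> and the other \<open>d + 1 - e\<close>
  digits are fresh; then fresh signs \<open>\<epsilon>'\<close> are drawn, and the other walkers line up around the new
  location of walker \<open>0\<close>. A round thus consumes \<open>d + 1\<close> fair coins altogether.

  Different walkers have different offsets in a formation (\<open>spin_inj\<close>). No collision occurs during a
  round because the signs that made the formation also steer walker \<open>0\<close>: since \<open>2 * \<epsilon> - spin \<epsilon> j\<close> lies
  between \<open>j\<close> and \<open>2 ^ (e + 1) - 2 - j\<close>, walker \<open>0\<close> jumps to a cyclic distance at least \<open>j\<close> from walker
  \<open>j\<close> (\<open>gap_bounds\<close>), while the walkers \<open>i < j\<close> follow it to within distance \<open>i\<close>.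

  Walker \<open>j\<close> is a random walk because its displacement in a round is \<open>1 + c'\<close>, where \<open>c'\<close> arises from
  \<open>c\<close> by taking the signs belonging to digits of \<open>j\<close> from \<open>\<epsilon>'\<close> instead of \<open>\<epsilon>\<close>. The remaining signs
  of \<open>\<epsilon>'\<close> have not influenced walker \<open>j\<close> and are uniform given its past; they serve in its next
  displacement. As the old unused signs and the fresh digits together correspond bijectively to \<open>c'\<close>
  and the new unused signs (\<open>code_bij\<close>), \<open>c'\<close> is uniform below \<open>m\<close> given the past
  (\<open>random_walk_hidden_state\<close>). A displacement uniform on \<open>1, \<dots>, m\<close> gives the walk with loops for
  \<open>n = m\<close> and the walk without loops for \<open>n = m + 1\<close>. For the walk with loops and \<open>n = m + 1\<close> there is
  one further letter, at which the whole flock rests.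

  So every round consumes one of \<open>N\<close> letters, where \<open>N\<close> is the number of neighbours of a vertex. The
  trajectories of all walkers up to time \<open>T\<close> have probability at least \<open>1 / N ^ (T + 1)\<close> if they are
  possible at all, and at most \<open>1 / N ^ T\<close> on account of walker \<open>0\<close> alone, whence both entropy rates are
  \<open>log N\<close> (\<open>entropy_X\<close>).

  The coupling is Markovian because the signs are visible. The walkers \<open>2 ^ b\<close> with \<open>b < e\<close> show
  walker \<open>0\<close> the current \<open>\<epsilon>\<close>; each walker \<open>2 ^ b\<close> tosses the coin for its own sign
  (\<open>kernel_coin\<close>); and the place of any other walker follows from those of the walkers before it
  (\<open>follow_composite\<close>). Where the flock may rest, walker \<open>j\<close> sees whether it does so in the
  present round: its distance to walker \<open>0\<close> is at most \<open>j\<close> if and only if walker \<open>0\<close> has not moved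
  (\<open>rests_iff\<close>).
\<close>

section \<open>Signed binary sums\<close>

abbreviation bitor :: "nat \<Rightarrow> nat \<Rightarrow> nat" where
  "bitor \<equiv> Bit_Operations.or"

text \<open>
  The sum of \<open>\<plusminus>2 ^ b\<close> over the binary digits \<open>b\<close> of \<open>j\<close>, with sign plus at the digits that \<open>\<epsilon>\<close> shares.
\<close>
definition spin :: "nat \<Rightarrow> nat \<Rightarrow> int" where
  "spin \<epsilon> j = 2 * int (and \<epsilon> j) - int j"

lemma and_plus_diff:
  fixes h j :: nat
  shows "and h j + xor h (and h j) = h"
proof -
  have "and (and h j) (xor h (and h j)) = 0"
    by (auto intro!: bit_eqI simp: bit_simps)
  then have "and h j + xor h (and h j) = bitor (and h j) (xor h (and h j))"
    by (rule disjunctive_add_eq_or)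
  also have "\<dots> = h"
    by (auto intro!: bit_eqI simp: bit_simps)
  finally show ?thesis .
qed

lemma diff_and_eq_xor: "h - and h j = xor h (and h (j :: nat))"
  using and_plus_diff[of h j] by linarith

lemma nat_and_le: "and (a::nat) b \<le> a" "and (a::nat) b \<le> b"
  using and_plus_diff[of a b] and_plus_diff[of b a] by (simp_all add: and.commute)

lemma nat_or_less: "a < 2 ^ e \<Longrightarrow> b < 2 ^ e \<Longrightarrow> bitor a b < (2::nat) ^ e"
  by (metis take_bit_nat_eq_self_iff take_bit_or)

lemma nat_xor_less: "a < 2 ^ e \<Longrightarrow> b < 2 ^ e \<Longrightarrow> xor a b < (2::nat) ^ e"
  by (metis take_bit_nat_eq_self_iff take_bit_xor)

lemma nat_plus_and_or: "and a b + bitor a b = a + (b::nat)"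
proof -
  have "int (and a b + bitor a b) = int (a + b)"
    by (simp add: of_nat_and_eq of_nat_or_eq plus_and_or)
  then show ?thesis by linarith
qed

lemma disjoint_parts:
  fixes h l j :: nat
  assumes "and h j = 0" "and l j = l"
  shows "h + l = bitor h l" "and (h + l) j = l"
proof -
  have *: "\<And>b. bit h b \<Longrightarrow> \<not> bit j b"
    using assms(1) by (auto simp: bit_eq_iff bit_simps)
  have **: "\<And>b. bit l b \<Longrightarrow> bit j b"
    using assms(2) by (auto simp: bit_eq_iff bit_simps)
  have "and h l = 0" by (simp add: bit_eq_iff bit_simps) (metis * **)
  then show 1: "h + l = bitor h l" by (rule disjunctive_add_eq_or)
  show "and (h + l) j = l"
    unfolding 1 by (simp add: bit_eq_iff bit_simps) (metis * **)
qed

lemma and_diff_and: "and (h - and h j) j = (0::nat)"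
proof -
  show ?thesis unfolding diff_and_eq_xor by (auto intro!: bit_eqI simp: bit_simps)
qed

lemma spin_bounds: "\<bar>spin \<epsilon> j\<bar> \<le> int j"
  using nat_and_le[of \<epsilon> j] by (simp add: spin_def)

text \<open>
  The form in which the bound on the gap between walkers is read off, because \<open>bitor \<epsilon> j\<close>
  lies between \<open>j\<close> and \<open>2 ^ e - 1\<close>.
\<close>
lemma two_times_minus_spin: "2 * int \<epsilon> - spin \<epsilon> j = 2 * int (bitor \<epsilon> j) - int j"
  using nat_plus_and_or[of \<epsilon> j] by (simp add: spin_def)

lemma spin_0 [simp]: "spin \<epsilon> 0 = 0"
  by (simp add: spin_def)

lemma spin_rec:
  "spin \<epsilon> j = 2 * spin (\<epsilon> div 2) (j div 2) + (if odd j then if odd \<epsilon> then 1 else - 1 else 0)"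
proof -
  have "int j = 2 * int (j div 2) + (if odd j then 1 else 0)" by presburger
  then show ?thesis unfolding spin_def by (subst and_nat_rec) (auto simp: algebra_simps)
qed

text \<open>
  The lowest digit of \<open>j\<close> is the parity of \<open>spin \<epsilon> j\<close>; after removing it, both sides can be halved.
\<close>
lemma spin_inj: "spin \<epsilon> i = spin \<epsilon> j \<Longrightarrow> i = j"
proof (induction "i + j" arbitrary: i j \<epsilon> rule: less_induct)
  case less
  have "even i = even j"
    using less.prems unfolding spin_rec[of \<epsilon> i] spin_rec[of \<epsilon> j] by (auto split: if_splits; presburger)
  with less.prems have "spin (\<epsilon> div 2) (i div 2) = spin (\<epsilon> div 2) (j div 2)"
    unfolding spin_rec[of \<epsilon> i] spin_rec[of \<epsilon> j] by (auto split: if_splits)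
  then have "i + j \<noteq> 0 \<Longrightarrow> i div 2 = j div 2" by (rule less.hyps[rotated]) linarith
  with \<open>even i = even j\<close> show ?case by (cases "i + j = 0") (simp, presburger)
qed

lemma spin_power: "spin \<epsilon> (2 ^ b) = (if bit \<epsilon> b then 2 ^ b else - (2 ^ b))"
proof -
  have "and \<epsilon> (2 ^ b) = (if bit \<epsilon> b then 2 ^ b else 0)"
    by (rule bit_eqI) (auto simp: bit_simps)
  then show ?thesis by (simp add: spin_def)
qed

lemma spin_add:
  assumes "j < 2 ^ b"
  shows "spin \<epsilon> (2 ^ b + j) = spin \<epsilon> (2 ^ b) + spin \<epsilon> j"
proof -
  have j: "and (2 ^ b) j = 0"
    using assms by (auto intro!: bit_eqI simp: bit_simps) (metis bit_take_bit_iff less_irrefl take_bit_nat_eq_self)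
  have "and \<epsilon> (2 ^ b + j) = bitor (and \<epsilon> (2 ^ b)) (and \<epsilon> j)"
    unfolding disjunctive_add_eq_or[OF j] by (auto intro!: bit_eqI simp: bit_simps)
  also have "\<dots> = and \<epsilon> (2 ^ b) + and \<epsilon> j"
  proof (rule disjunctive_add_eq_or[symmetric])
    have "and (and \<epsilon> (2 ^ b)) (and \<epsilon> j) = and \<epsilon> (and (2 ^ b) j)"
      by (simp add: ac_simps)
    then show "and (and \<epsilon> (2 ^ b)) (and \<epsilon> j) = 0" by (simp add: j)
  qed
  finally show ?thesis by (simp add: spin_def)
qed

text \<open>
  Flipping signs outside the digits of \<open>j\<close> changes the part of \<open>r\<close> that does not matter for \<open>j\<close>, and
  nothing else.
\<close>
lemma xor_free:
  assumes "and u j = 0"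
  shows "and (xor r u) j = and r j" "xor r u - and (xor r u) j = xor (r - and r j) (u :: nat)"
proof -
  have *: "\<not> (bit u b \<and> bit j b)" for b using assms by (metis bit_0_eq bit_and_iff bot_apply bot_bool_def)
  show 1: "and (xor r u) j = and r j"
    by (rule bit_eqI) (use * in \<open>auto simp: bit_simps\<close>)
  show "xor r u - and (xor r u) j = xor (r - and r j) u"
    unfolding 1 diff_and_eq_xor[of "xor r u" j, unfolded 1] diff_and_eq_xor[of r j]
    by (simp add: xor.assoc xor.commute[of u])
qed

section \<open>Independent letters\<close>

definition word_space :: "(nat \<Rightarrow> 'a pmf) \<Rightarrow> (nat \<Rightarrow> 'a) measure" where
  "word_space p = PiM UNIV (\<lambda>t. measure_pmf (p t))"

text \<open>
  \<open>f\<close> is a function of the letters up to time \<open>t\<close>. For countable alphabets this replaces every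
  measurability argument.
\<close>
definition determined :: "nat \<Rightarrow> ((nat \<Rightarrow> 'a) \<Rightarrow> 'b) \<Rightarrow> bool" where
  "determined t f \<longleftrightarrow> (\<forall>\<omega> \<omega>'. (\<forall>s\<le>t. \<omega> s = \<omega>' s) \<longrightarrow> f \<omega> = f \<omega>')"

lemma prob_space_word_space: "prob_space (word_space p)"
  unfolding word_space_def by (intro prob_space_PiM measure_pmf.prob_space_axioms)

lemma space_word_space [simp]: "space (word_space p) = UNIV"
  by (simp add: word_space_def space_PiM)

text \<open>
  The finite word of the first \<open>t + 1\<close> letters has countably many values, so any function of it is
  measurable, whatever its target.
\<close>
lemma measurable_determined:
  fixes p :: "nat \<Rightarrow> 'a :: countable pmf"
  assumes "determined t f"
  shows "f \<in> measurable (word_space p) (count_space UNIV)"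
proof -
  define g where "g = (\<lambda>l. f (\<lambda>s. if s \<le> t then l ! s else undefined))"
  have f: "f = (\<lambda>\<omega>. g (map \<omega> [0..<Suc t]))"
    unfolding g_def
    by (rule ext, rule assms[unfolded determined_def, rule_format]) (simp del: upt_Suc)
  have coord: "(\<lambda>\<omega>. \<omega> s) \<in> measurable (word_space p) (count_space UNIV)" for s
    unfolding word_space_def
    using measurable_component_singleton[of s UNIV "\<lambda>t. measure_pmf (p t)"] by simp
  have "(\<lambda>\<omega>. map \<omega> xs) \<in> measurable (word_space p) (count_space UNIV)" for xs :: "nat list"
  proof (induction xs)
    case (Cons s xs)
    have "(\<lambda>\<omega>. a # map \<omega> xs) \<in> measurable (word_space p) (count_space UNIV)" for a :: 'a
      using Cons by (rule measurable_compose) simp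
    then show ?case
      using measurable_compose_countable[where f = "\<lambda>a \<omega>. a # map \<omega> xs", OF _ coord] by simp
  qed simp
  then show ?thesis unfolding f by (rule measurable_compose) simp
qed

lemma sets_determined:
  fixes p :: "nat \<Rightarrow> 'a :: countable pmf"
  assumes "determined t P"
  shows "{\<omega>. P \<omega>} \<in> sets (word_space p)"
  using measurable_determined[OF assms, of p, THEN measurable_sets, of "{True}"]
  by (simp add: vimage_def)

text \<open>
  Conditioning on the letter at time \<open>i\<close>, which is independent of all the others: the product
  measure is unchanged when that letter is replaced by an independent copy.
\<close>
lemma prob_resample:
  fixes p :: "nat \<Rightarrow> nat pmf"
  assumes P: "determined t P" and p: "p i = pmf_of_set {..<b}" and "0 < b"
  shows "measure (word_space p) {\<omega>. P \<omega>}
           = (\<Sum>r<b. measure (word_space p) {\<omega>. P (fun_upd \<omega> i r)}) / real b"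
proof -
  interpret W: prob_space "word_space p" by (rule prob_space_word_space)
  have S: "{\<omega>. P \<omega>} \<in> sets (word_space p)" using P by (rule sets_determined)
  let ?g = "\<lambda>(x, X). X(i := x)"
  have ms: "?g \<in> measurable (measure_pmf (p i) \<Otimes>\<^sub>M word_space p) (word_space p)"
    unfolding word_space_def case_prod_beta
    by (rule measurable_fun_upd[where J = UNIV]) (auto intro: measurable_snd measurable_fst)
  have eq: "distr (measure_pmf (p i) \<Otimes>\<^sub>M word_space p) (word_space p) ?g = word_space p"
    using distr_pair_PiM_eq_PiM[of UNIV "\<lambda>t. measure_pmf (p t)" i]
    by (simp add: word_space_def measure_pmf.prob_space_axioms)
  have "emeasure (word_space p) {\<omega>. P \<omega>}
          = emeasure (measure_pmf (p i) \<Otimes>\<^sub>M word_space p) (?g -` {\<omega>. P \<omega>} \<inter> space (measure_pmf (p i) \<Otimes>\<^sub>M word_space p))"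
    by (subst eq[symmetric], rule emeasure_distr[OF ms S])
  also have "\<dots> = (\<integral>\<^sup>+r. emeasure (word_space p) (Pair r -` (?g -` {\<omega>. P \<omega>} \<inter> space (measure_pmf (p i) \<Otimes>\<^sub>M word_space p))) \<partial>measure_pmf (p i))"
    by (rule W.emeasure_pair_measure_alt[OF measurable_sets[OF ms S]])
  also have "\<dots> = (\<integral>\<^sup>+r. ennreal (W.prob {\<omega>. P (fun_upd \<omega> i r)}) \<partial>measure_pmf (p i))"
    by (intro nn_integral_cong) (simp add: space_pair_measure vimage_def W.emeasure_eq_measure)
  also have "\<dots> = ennreal (\<integral>r. W.prob {\<omega>. P (fun_upd \<omega> i r)} \<partial>measure_pmf (p i))"
    by (intro nn_integral_eq_integral measure_pmf.integrable_const_bound[where B = 1]) auto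
  also have "(\<integral>r. W.prob {\<omega>. P (fun_upd \<omega> i r)} \<partial>measure_pmf (p i))
               = (\<Sum>r<b. W.prob {\<omega>. P (fun_upd \<omega> i r)}) / real b"
    unfolding p using \<open>0 < b\<close> by (subst integral_pmf_of_set) (auto simp: lessThan_empty_iff)
  finally show ?thesis
    by (simp add: W.emeasure_eq_measure sum_nonneg)
qed

lemma determined_mono: "determined s f \<Longrightarrow> s \<le> t \<Longrightarrow> determined t f"
  unfolding determined_def by (meson order_trans)

lemma determined_comp: "determined t f \<Longrightarrow> determined t (\<lambda>\<omega>. g (f \<omega>))"
  unfolding determined_def by metis

lemma determined_conj:
  "determined t P \<Longrightarrow> determined t Q \<Longrightarrow> determined t (\<lambda>\<omega>. P \<omega> \<and> Q \<omega>)"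
  unfolding determined_def by metis

lemma determined_ball:
  "(\<And>s. s \<in> S \<Longrightarrow> determined t (P s)) \<Longrightarrow> determined t (\<lambda>\<omega>. \<forall>s\<in>S. P s \<omega>)"
  unfolding determined_def by meson

lemma determined_past:
  assumes "\<And>s. determined s (Y s)"
  shows "determined t (\<lambda>\<omega>. \<forall>s\<le>t. Y s \<omega> = x s)"
proof -
  have "determined t (\<lambda>\<omega>. \<forall>s\<in>{..t}. Y s \<omega> = x s)"
    using assms by (intro determined_ball determined_comp[where g = "\<lambda>y. y = x _"])
      (auto intro: determined_mono)
  then show ?thesis by (simp add: Ball_def)
qed

lemma determined_fun_upd: "determined t f \<Longrightarrow> t < i \<Longrightarrow> f (fun_upd \<omega> i r) = f \<omega>"
  unfolding determined_def by (metis fun_upd_other not_less)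

lemma prob_partition:
  fixes p :: "nat \<Rightarrow> 'a :: countable pmf"
  assumes "determined t P" "determined t f" "finite H" "\<And>\<omega>. f \<omega> \<in> H"
  shows "measure (word_space p) {\<omega>. P \<omega>}
           = (\<Sum>a\<in>H. measure (word_space p) {\<omega>. P \<omega> \<and> f \<omega> = a})"
proof -
  interpret prob_space "word_space p" by (rule prob_space_word_space)
  have "{\<omega>. P \<omega>} = (\<Union>a\<in>H. {\<omega>. P \<omega> \<and> f \<omega> = a})" using assms(4) by auto
  moreover have "{\<omega>. P \<omega> \<and> f \<omega> = a} \<in> sets (word_space p)" for a
    using assms(1,2) by (intro sets_determined determined_conj determined_comp[where g = "\<lambda>y. y = a"])
  ultimately show ?thesis
    using finite_measure_finite_Union[OF assms(3), of "\<lambda>a. {\<omega>. P \<omega> \<and> f \<omega> = a}"]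
    by (auto simp: disjoint_family_on_def)
qed

lemma prob_cong_AE:
  fixes p :: "nat \<Rightarrow> 'a :: countable pmf"
  assumes "determined t P" "determined t Q" "AE \<omega> in word_space p. P \<omega> \<longleftrightarrow> Q \<omega>"
  shows "measure (word_space p) {\<omega>. P \<omega>} = measure (word_space p) {\<omega>. Q \<omega>}"
proof -
  interpret prob_space "word_space p" by (rule prob_space_word_space)
  show ?thesis
    using assms(3) by (intro finite_measure_eq_AE sets_determined[OF assms(1)] sets_determined[OF assms(2)]) simp
qed

text \<open>
  A uniform choice among finitely many words of length \<open>t + 1\<close> gives every event a multiple of the
  probability of one word.
\<close>
lemma prob_granular:
  fixes p :: "nat \<Rightarrow> nat pmf"
  assumes p: "\<And>s. p s = pmf_of_set {..<b s}" and b: "\<And>s. 0 < b s" and P: "determined t P"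
  shows "\<exists>c::nat. measure (word_space p) {\<omega>. P \<omega>} = real c / real (\<Prod>s\<le>t. b s)"
proof -
  interpret prob_space "word_space p" by (rule prob_space_word_space)
  have "\<exists>c::nat. prob {\<omega>. P \<omega>} = real c / real (\<Prod>s<u. b s)"
    if "\<And>\<omega> \<omega>'. (\<forall>s<u. \<omega> s = \<omega>' s) \<Longrightarrow> P \<omega> = P \<omega>'" for u and P :: "(nat \<Rightarrow> nat) \<Rightarrow> bool"
    using that
  proof (induction u arbitrary: P)
    case 0
    then have "{\<omega>. P \<omega>} = UNIV \<or> {\<omega>. P \<omega>} = {}" by blast
    then have "prob {\<omega>. P \<omega>} = real 1 \<or> prob {\<omega>. P \<omega>} = real 0"
      using prob_space by auto
    then show ?case by (metis div_by_1 lessThan_0 of_nat_1 prod.empty)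
  next
    case (Suc u)
    have "\<exists>c::nat. prob {\<omega>. P (fun_upd \<omega> u r)} = real c / real (\<Prod>s<u. b s)" for r
      by (rule Suc.IH, rule Suc.prems) (simp add: less_Suc_eq)
    then obtain c :: "nat \<Rightarrow> nat" where
      c: "\<And>r. prob {\<omega>. P (fun_upd \<omega> u r)} = real (c r) / real (\<Prod>s<u. b s)" by metis
    have "determined u P"
      unfolding determined_def using Suc.prems by (simp add: less_Suc_eq_le)
    then have "prob {\<omega>. P \<omega>} = (\<Sum>r<b u. real (c r) / real (\<Prod>s<u. b s)) / real (b u)"
      using prob_resample[where p = p and i = u, OF _ p b] by (simp only: c)
    also have "\<dots> = real (\<Sum>r<b u. c r) / real (\<Prod>s<Suc u. b s)"
      by (simp add: sum_divide_distrib)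
    finally show ?case by blast
  qed
  from this[of "Suc t" P] P show ?thesis
    unfolding determined_def lessThan_Suc_atMost less_Suc_eq_le by blast
qed

section \<open>Walks that hide a uniform state\<close>

text \<open>
  A Markov chain \<open>(Y, h)\<close> whose visible part is a random walk. If \<open>h t\<close> is uniform on \<open>H\<close> given the past
  of \<open>Y\<close> and the fresh letter is uniform too, then the bijection turns the uniform pair of state and
  letter into a uniform pair of neighbour and new state. So the next location is uniform among the
  neighbours, and the new state is again uniform given the longer past; the induction closes.
\<close>
lemma random_walk_hidden_state:
  fixes p :: "nat \<Rightarrow> nat pmf" and Y :: "nat \<Rightarrow> (nat \<Rightarrow> nat) \<Rightarrow> 'v"
    and h :: "nat \<Rightarrow> (nat \<Rightarrow> nat) \<Rightarrow> 'h"
  assumes fresh: "\<And>t. p (Suc t) = pmf_of_set {..<b}" and b: "0 < b"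
    and det: "\<And>t. determined t (Y t)" "\<And>t. determined t (h t)"
    and Y: "\<And>t \<omega>. Y t \<omega> \<in> V" and h: "\<And>t \<omega>. h t \<omega> \<in> H" and H: "finite H"
    and step: "\<And>t \<omega>. \<omega> (Suc t) < b \<Longrightarrow> (Y (Suc t) \<omega>, h (Suc t) \<omega>) = g (Y t \<omega>) (h t \<omega>) (\<omega> (Suc t))"
    and bij: "\<And>y. y \<in> V \<Longrightarrow> bij_betw (\<lambda>(a, r). g y a r) (H \<times> {..<b}) (E `` {y} \<times> H)"
    and init: "\<And>y a a'. a \<in> H \<Longrightarrow> a' \<in> H \<Longrightarrow>
      measure (word_space p) {\<omega>. Y 0 \<omega> = y \<and> h 0 \<omega> = a} =
      measure (word_space p) {\<omega>. Y 0 \<omega> = y \<and> h 0 \<omega> = a'}"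
  shows "random_walk (word_space p) V E Y"
proof -
  interpret prob_space "word_space p" by (rule prob_space_word_space)
  define Q where "Q t x a = prob {\<omega>. (\<forall>s\<le>t. Y s \<omega> = x s) \<and> h t \<omega> = a}" for t x a
  have sumQ: "prob {\<omega>. \<forall>s\<le>t. Y s \<omega> = x s} = (\<Sum>a\<in>H. Q t x a)" for t x
    unfolding Q_def
    by (rule prob_partition[OF determined_past det(2) H h]) (rule det)
  have Q_Suc: "Q (Suc t) x a = (\<Sum>r<b. \<Sum>a0\<in>H. if g (x t) a0 r = (x (Suc t), a) then Q t x a0 else 0) / b"
    for t x a
  proof -
    have "Q (Suc t) x a = (\<Sum>r<b. prob {\<omega>. (\<forall>s\<le>Suc t. Y s (fun_upd \<omega> (Suc t) r) = x s) \<and> h (Suc t) (fun_upd \<omega> (Suc t) r) = a}) / b"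
      unfolding Q_def using fresh b
      by (intro prob_resample[where t = "Suc t"] determined_conj determined_past det determined_comp[where g = "\<lambda>y. y = a"])
    also have "(\<Sum>r<b. prob {\<omega>. (\<forall>s\<le>Suc t. Y s (fun_upd \<omega> (Suc t) r) = x s) \<and> h (Suc t) (fun_upd \<omega> (Suc t) r) = a})
      = (\<Sum>r<b. \<Sum>a0\<in>H. if g (x t) a0 r = (x (Suc t), a) then Q t x a0 else 0)"
      (is "(\<Sum>r<b. ?l r) = (\<Sum>r<b. ?r r)")
    proof (rule sum.cong[OF refl])
      fix r
      assume "r \<in> {..<b}"
      have "((\<forall>s\<le>Suc t. Y s (fun_upd \<omega> (Suc t) r) = x s) \<and> h (Suc t) (fun_upd \<omega> (Suc t) r) = a)
          \<longleftrightarrow> (\<forall>s\<le>t. Y s \<omega> = x s) \<and> g (x t) (h t \<omega>) r = (x (Suc t), a)" for \<omega>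
      proof -
        have 1: "Y s (fun_upd \<omega> (Suc t) r) = Y s \<omega>" if "s \<le> t" for s
          using that by (intro determined_fun_upd[OF det(1)]) simp
        have 2: "h t (fun_upd \<omega> (Suc t) r) = h t \<omega>"
          by (intro determined_fun_upd[OF det(2)]) simp
        show ?thesis
          using step[of "fun_upd \<omega> (Suc t) r" t] \<open>r \<in> {..<b}\<close> by (auto simp: 1 2 le_Suc_eq)
      qed
      then have "?l r = prob {\<omega>. (\<forall>s\<le>t. Y s \<omega> = x s) \<and> g (x t) (h t \<omega>) r = (x (Suc t), a)}"
        by simp
      also have "\<dots> = (\<Sum>a0\<in>H. prob {\<omega>. ((\<forall>s\<le>t. Y s \<omega> = x s) \<and> g (x t) (h t \<omega>) r = (x (Suc t), a)) \<and> h t \<omega> = a0})"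
        by (rule prob_partition[OF _ det(2) H h])
           (intro determined_conj determined_past det determined_comp[OF det(2)])
      also have "\<dots> = ?r r"
      proof (rule sum.cong[OF refl])
        fix a0
        show "prob {\<omega>. ((\<forall>s\<le>t. Y s \<omega> = x s) \<and> g (x t) (h t \<omega>) r = (x (Suc t), a)) \<and> h t \<omega> = a0}
          = (if g (x t) a0 r = (x (Suc t), a) then Q t x a0 else 0)"
        proof -
          have "{\<omega>. ((\<forall>s\<le>t. Y s \<omega> = x s) \<and> g (x t) (h t \<omega>) r = (x (Suc t), a)) \<and> h t \<omega> = a0}
            = (if g (x t) a0 r = (x (Suc t), a) then {\<omega>. (\<forall>s\<le>t. Y s \<omega> = x s) \<and> h t \<omega> = a0} else {})"
            by auto
          then show ?thesis by (simp add: Q_def)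
        qed
      qed
      finally show "?l r = ?r r" .
    qed
    finally show ?thesis .
  qed
  \<comment> \<open>Exactly one pair of state and letter leads to a given neighbour and a given new state.\<close>
  have Q_const_Suc: "Q (Suc t) x a = (if x (Suc t) \<in> E `` {x t} then q / b else 0)"
    if q: "\<And>a. a \<in> H \<Longrightarrow> Q t x a = q" and V: "x t \<in> V" and a: "a \<in> H" for t x a q
  proof -
    let ?S = "{z \<in> H \<times> {..<b}. (\<lambda>(a, r). g (x t) a r) z = (x (Suc t), a)}"
    have "(\<Sum>r<b. \<Sum>a0\<in>H. if g (x t) a0 r = (x (Suc t), a) then Q t x a0 else 0)
      = (\<Sum>r<b. \<Sum>a0\<in>H. if g (x t) a0 r = (x (Suc t), a) then q else 0)"
      by (intro sum.cong refl) (simp add: q)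
    also have "\<dots> = (\<Sum>z\<in>H \<times> {..<b}. if (\<lambda>(a, r). g (x t) a r) z = (x (Suc t), a) then q else 0)"
      by (subst sum.swap) (simp add: sum.cartesian_product case_prod_beta)
    also have "\<dots> = real (card ?S) * q"
      using H by (simp add: sum.If_cases Int_def)
    also have "card ?S = (if x (Suc t) \<in> E `` {x t} then 1 else 0)"
    proof (cases "x (Suc t) \<in> E `` {x t}")
      case True
      then have "(x (Suc t), a) \<in> (\<lambda>(a, r). g (x t) a r) ` (H \<times> {..<b})"
        using bij[OF V] a by (auto simp: bij_betw_def)
      then obtain z where "z \<in> H \<times> {..<b}" "(\<lambda>(a, r). g (x t) a r) z = (x (Suc t), a)" by force
      then have "?S = {z}"
        using bij_betw_imp_inj_on[OF bij[OF V]] unfolding inj_on_def by fastforce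
      then show ?thesis using True by simp
    next
      case False
      then have "?S = {}" using bij[OF V] by (force simp: bij_betw_def)
      then show ?thesis using False by (simp only: card.empty if_False)
    qed
    finally show ?thesis unfolding Q_Suc by simp
  qed
  have off: "Q t x a = 0" if "x s \<notin> V" "s \<le> t" for t x s a
  proof -
    have "Y s \<omega> \<noteq> x s" for \<omega> using that(1) Y[of s \<omega>] by auto
    then have "{\<omega>. (\<forall>s\<le>t. Y s \<omega> = x s) \<and> h t \<omega> = a} = {}" using that(2) by blast
    then show ?thesis by (simp only: Q_def measure_empty)
  qed
  have const: "Q t x a = Q t x a'" if "a \<in> H" "a' \<in> H" for t x a a'
    using that
  proof (induction t arbitrary: a a')
    case 0
    then show ?case using init[of a a' "x 0"] by (simp add: Q_def)
  next
    case (Suc t)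
    show ?case
    proof (cases "x t \<in> V")
      case True
      then show ?thesis
        using Q_const_Suc[of t x "Q t x a", OF Suc.IH True] Suc.prems by presburger
    next
      case False
      then show ?thesis by (simp add: off[of x t])
    qed
  qed
  have hist: "prob {\<omega>. \<forall>s\<le>t. Y s \<omega> = x s} = card H * Q t x a" if "a \<in> H" for t x a
  proof -
    have "(\<Sum>a'\<in>H. Q t x a') = (\<Sum>a'\<in>H. Q t x a)"
      by (intro sum.cong refl const that)
    then show ?thesis unfolding sumQ by simp
  qed
  show ?thesis
    unfolding random_walk_def
  proof (intro conjI allI impI prob_space_axioms)
    fix t
    show "Y t \<in> measurable (word_space p) (count_space V)"
      using measurable_determined[OF det(1), where p = p] Y by (auto simp: measurable_def)
  next
    fix t x v
    assume "0 < \<P>(\<omega> in word_space p. \<forall>s\<le>t. Y s \<omega> = x s)"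
    then have pos: "0 < prob {\<omega>. \<forall>s\<le>t. Y s \<omega> = x s}" by simp
    obtain a where a: "a \<in> H" using h by blast
    have V: "x t \<in> V"
      using pos off[of x t t] by (force simp: sumQ)
    have P1: "prob {\<omega>. \<forall>s\<le>t. Y s \<omega> = x s} = card H * Q t x a"
      by (rule hist[OF a])
    have "prob {\<omega>. Y (Suc t) \<omega> = v \<and> (\<forall>s\<le>t. Y s \<omega> = x s)}
      = prob {\<omega>. \<forall>s\<le>Suc t. Y s \<omega> = (x(Suc t := v)) s}"
      by (intro arg_cong[where f = prob]) (auto simp: le_Suc_eq)
    also have "\<dots> = card H * Q (Suc t) (x(Suc t := v)) a"
      by (rule hist[OF a])
    also have "Q (Suc t) (x(Suc t := v)) a = (if v \<in> E `` {x t} then Q t x a / b else 0)"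
    proof -
      have "Q t (x(Suc t := v)) a' = Q t x a" if "a' \<in> H" for a'
        using const[OF that a, of t x] by (simp add: Q_def)
      then show ?thesis
        using Q_const_Suc[of t "x(Suc t := v)" "Q t x a" a] V a by simp
    qed
    finally have P2: "prob {\<omega>. Y (Suc t) \<omega> = v \<and> (\<forall>s\<le>t. Y s \<omega> = x s)}
      = (if v \<in> E `` {x t} then prob {\<omega>. \<forall>s\<le>t. Y s \<omega> = x s} / b else 0)"
      by (simp add: P1)
    have "card H * b = card (E `` {x t}) * card H"
      using bij_betw_same_card[OF bij[OF V]] by (simp add: card_cartesian_product)
    moreover have "card H \<noteq> 0" using a H by auto
    ultimately have "card (E `` {x t}) = b" by simp
    then show "\<P>(\<omega> in word_space p. Y (Suc t) \<omega> = v \<bar> \<forall>s\<le>t. Y s \<omega> = x s)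
      = (if v \<in> E `` {x t} then 1 / real (card (E `` {x t})) else 0)"
      using pos b unfolding cond_prob_def by (simp add: P2)
  qed
qed

lemma random_walk_trajectory_prob_le:
  assumes rw: "random_walk M V E X" and card: "\<And>v. v \<in> V \<Longrightarrow> card (E `` {v}) = b"
  shows "measure M {\<omega> \<in> space M. \<forall>s\<le>t. X s \<omega> = x s} \<le> (1 / real b) ^ t"
proof -
  interpret prob_space M using rw by (simp add: random_walk_def)
  have X: "X s \<in> measurable M (count_space V)" for s using rw by (simp add: random_walk_def)
  have ev: "{\<omega> \<in> space M. X s \<omega> = y} \<in> sets M" for s y
  proof -
    have "{\<omega> \<in> space M. X s \<omega> = y} = X s -` ({y} \<inter> V) \<inter> space M"
      using measurable_space[OF X, of _ s] by auto
    then show ?thesis using measurable_sets[OF X, of "{y} \<inter> V" s] by simp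
  qed
  have sets: "{\<omega> \<in> space M. \<forall>s\<le>t. X s \<omega> = x s} \<in> sets M" for t
  proof -
    have "{\<omega> \<in> space M. \<forall>s\<le>t. X s \<omega> = x s} = (\<Inter>s\<in>{..t}. {\<omega> \<in> space M. X s \<omega> = x s})" by auto
    then show ?thesis using ev by auto
  qed
  show ?thesis
  proof (induction t)
    case 0
    then show ?case by simp
  next
    case (Suc t)
    let ?A = "{\<omega> \<in> space M. \<forall>s\<le>t. X s \<omega> = x s}"
    have eq: "{\<omega> \<in> space M. \<forall>s\<le>Suc t. X s \<omega> = x s}
      = {\<omega> \<in> space M. X (Suc t) \<omega> = x (Suc t) \<and> (\<forall>s\<le>t. X s \<omega> = x s)}"
      by (auto simp: le_Suc_eq)
    show ?case
    proof (cases "prob ?A = 0")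
      case True
      have "prob {\<omega> \<in> space M. \<forall>s\<le>Suc t. X s \<omega> = x s} \<le> prob ?A"
        by (intro finite_measure_mono sets) auto
      then have "prob {\<omega> \<in> space M. \<forall>s\<le>Suc t. X s \<omega> = x s} \<le> 0" using True by simp
      then show ?thesis by (rule order_trans) simp
    next
      case False
      then have pos: "0 < prob ?A" by (simp add: less_le)
      have "?A \<noteq> {}" using pos by (metis less_irrefl measure_empty)
      then obtain \<omega> where "\<omega> \<in> space M" "X t \<omega> = x t" by auto
      then have "x t \<in> V" using measurable_space[OF X, of \<omega> t] by simp
      then have "\<P>(\<omega> in M. X (Suc t) \<omega> = x (Suc t) \<bar> \<forall>s\<le>t. X s \<omega> = x s) \<le> 1 / real b"
        using rw pos card unfolding random_walk_def by simp
      then have "prob {\<omega> \<in> space M. \<forall>s\<le>Suc t. X s \<omega> = x s} \<le> 1 / real b * prob ?A"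
        unfolding eq cond_prob_def pos_divide_le_eq[OF pos] .
      also have "\<dots> \<le> 1 / real b * (1 / real b) ^ t" using Suc by (intro mult_left_mono) auto
      finally show ?thesis by simp
    qed
  qed
qed

section \<open>Entropy of nearly uniform variables\<close>

text \<open>
  Entropy is the mean of \<open>- log 2 (q y)\<close>, and this quantity lies between \<open>a\<close> and \<open>b\<close> for every value
  \<open>y\<close> that is taken with positive probability.
\<close>
lemma shannon_entropy_bounds:
  assumes "prob_space M" and Y: "Y \<in> measurable M (count_space UNIV)"
    and fin: "finite (Y ` space M)"
    and lo: "\<And>y. y \<in> Y ` space M \<Longrightarrow> measure M {\<omega> \<in> space M. Y \<omega> = y} \<noteq> 0 \<Longrightarrow>
               2 powr (- b) \<le> measure M {\<omega> \<in> space M. Y \<omega> = y}"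
    and hi: "\<And>y. y \<in> Y ` space M \<Longrightarrow> measure M {\<omega> \<in> space M. Y \<omega> = y} \<le> 2 powr (- a)"
  shows "shannon_entropy M Y \<in> {a..b}"
proof -
  interpret prob_space M by fact
  interpret information_space M 2 by standard simp
  define q where "q y = measure M {\<omega> \<in> space M. Y \<omega> = y}" for y
  have eq: "Y -` {y} \<inter> space M = {\<omega> \<in> space M. Y \<omega> = y}" for y by auto
  have ev: "{\<omega> \<in> space M. Y \<omega> = y} \<in> sets M" for y
    using measurable_sets[OF Y, of "{y}"] unfolding eq by simp
  have sf: "simple_function M Y"
    unfolding simple_function_def eq using fin ev by auto
  have sd: "simple_distributed M Y q"
    by (rule simple_distributedI[OF sf]) (auto simp: q_def eq)
  have H: "shannon_entropy M Y = - (\<Sum>y\<in>Y ` space M. q y * log 2 (q y))"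
    unfolding shannon_entropy_def by (rule entropy_simple_distributed[OF sd])
  have one: "(\<Sum>y\<in>Y ` space M. q y) = 1"
    using simple_distributed_sum_space[OF sd] .
  have "a * q y \<le> - (q y * log 2 (q y)) \<and> - (q y * log 2 (q y)) \<le> b * q y"
    if y: "y \<in> Y ` space M" for y
  proof (cases "q y = 0")
    case False
    then have pos: "0 < q y" unfolding q_def using measure_nonneg[of M] by (simp add: less_le)
    have "log 2 (q y) \<le> log 2 (2 powr (- a))"
      using pos hi[OF y] by (subst log_le_cancel_iff) (auto simp: q_def)
    moreover have "log 2 (2 powr (- b)) \<le> log 2 (q y)"
      using pos lo[OF y] False by (subst log_le_cancel_iff) (auto simp: q_def)
    ultimately have "a \<le> - log 2 (q y)" "- log 2 (q y) \<le> b" by simp_all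
    then have "q y * a \<le> q y * - log 2 (q y)" "q y * - log 2 (q y) \<le> q y * b"
      using pos by (simp_all only: mult_le_cancel_left_pos)
    then show ?thesis by (simp add: mult.commute[of _ "q y"])
  qed simp
  then have "(\<Sum>y\<in>Y ` space M. a * q y) \<le> (\<Sum>y\<in>Y ` space M. - (q y * log 2 (q y)))"
    "(\<Sum>y\<in>Y ` space M. - (q y * log 2 (q y))) \<le> (\<Sum>y\<in>Y ` space M. b * q y)"
    by (auto intro!: sum_mono)
  then show ?thesis
    by (simp add: H one sum_negf flip: sum_distrib_left)
qed

section \<open>The flock\<close>

lemma nat_mod_eq_iff:
  assumes "0 < n"
  shows "nat (a mod int n) = nat (b mod int n) \<longleftrightarrow> int n dvd a - b"
  using assms by (metis eq_nat_nat_iff mod_eq_dvd_iff of_nat_0_less_iff pos_mod_sign)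

lemma not_dvd_small: "z \<noteq> 0 \<Longrightarrow> \<bar>z\<bar> < int n \<Longrightarrow> \<not> int n dvd z"
  using dvd_imp_le_int[of z "int n"] by auto

text \<open>
  \<open>N\<close> is the number of vertices to which a walker can move: \<open>N = n\<close> for the graph with loops and
  \<open>N = n - 1\<close> without. Choosing \<open>e\<close> minimal makes \<open>2 ^ b\<close> the number of an actual walker for all \<open>b < e\<close>, so
  that every sign of the formation can be seen from the locations.
\<close>
locale flock =
  fixes d e k n N :: nat
  assumes e_le: "e \<le> d" and k_le: "k \<le> 2 ^ e" and k_pos: "1 \<le> k"
    and k_gt: "\<And>b. b < e \<Longrightarrow> 2 ^ b < k"
    and sizes: "n = 2 ^ (d + 1) \<and> N = n \<or> n = 2 ^ (d + 1) + 1 \<and> (N = n \<or> N = n - 1)"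
begin

abbreviation m :: nat where "m \<equiv> 2 ^ (d + 1)"

text \<open>
  The binary digits of \<open>f\<close>, spread over the positions \<open>0\<close> and \<open>e + 1, e + 2, \<dots>\<close>. The positions
  \<open>1, \<dots>, e\<close> are left free for the signs.
\<close>
definition outer_digits :: "nat \<Rightarrow> nat" where
  "outer_digits f = f mod 2 + 2 ^ (e + 1) * (f div 2)"

text \<open>
  A letter \<open>r < m\<close> consists of the new signs, its lowest \<open>e\<close> digits, and of \<open>d + 1 - e\<close> further
  digits for the displacement of walker \<open>0\<close>. The letter \<open>r = m\<close>, which occurs only if \<open>N = m + 1\<close>, makes
  the flock rest.
\<close>
definition step :: "int \<times> nat \<Rightarrow> nat \<Rightarrow> int \<times> nat" where
  "step s r = (if r < m
     then (fst s + 1 + int (outer_digits (r div 2 ^ e)) + 2 * int (snd s), r mod 2 ^ e) else s)"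

text \<open>
  The first component is the location of walker \<open>0\<close>, not reduced modulo \<open>n\<close>; the second is the row of
  signs.
\<close>
primrec state :: "nat \<Rightarrow> (nat \<Rightarrow> nat) \<Rightarrow> int \<times> nat" where
  "state 0 \<omega> = (0, \<omega> 0 mod 2 ^ e)"
| "state (Suc t) \<omega> = step (state t \<omega>) (\<omega> (Suc t))"

definition pos :: "int \<times> nat \<Rightarrow> nat \<Rightarrow> nat" where
  "pos s j = nat ((fst s + spin (snd s) j) mod int n)"

definition X :: "nat \<Rightarrow> nat \<Rightarrow> (nat \<Rightarrow> nat) \<Rightarrow> nat" where
  "X j t \<omega> = pos (state t \<omega>) j"

text \<open>
  The letter at time \<open>0\<close> only has to supply uniform signs. For \<open>e > 0\<close> a uniform number below \<open>m + 1\<close>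
  would not do this, since its lowest \<open>e\<close> digits are not uniform.
\<close>
definition letters :: "nat \<Rightarrow> nat pmf" where
  "letters t = pmf_of_set {..<(case t of 0 \<Rightarrow> 2 ^ e | Suc _ \<Rightarrow> N)}"

abbreviation W :: "(nat \<Rightarrow> nat) measure" where "W \<equiv> word_space letters"

abbreviation V :: "nat set" where "V \<equiv> complete_verts n"

definition E :: "(nat \<times> nat) set" where
  "E = (if N = n then complete_loop_edges n else complete_edges n)"

lemma m_ge: "2 ^ (e + 1) \<le> m"
  using e_le by (intro power_increasing) auto

lemma m_le_N: "m \<le> N" and N_le_n: "N \<le> n" and N_le: "N \<le> m + 1" and n_pos: "0 < n" and N_pos: "0 < N"
  using sizes by auto

lemma snd_step: "snd s < 2 ^ e \<Longrightarrow> snd (step s r) < 2 ^ e"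
  by (simp add: step_def)

lemma snd_state: "snd (state t \<omega>) < 2 ^ e"
  by (induction t) (simp_all add: snd_step)

lemma pos_less: "pos s j < n"
  using n_pos by (simp add: pos_def nat_less_iff)

lemma determined_state: "determined t (state t)"
proof (induction t)
  case 0
  then show ?case by (simp add: determined_def)
next
  case (Suc t)
  show ?case unfolding determined_def
  proof (intro allI impI)
    fix \<omega> \<omega>' :: "nat \<Rightarrow> nat"
    assume *: "\<forall>s\<le>Suc t. \<omega> s = \<omega>' s"
    then have "state t \<omega> = state t \<omega>'" using Suc unfolding determined_def by simp
    then show "state (Suc t) \<omega> = state (Suc t) \<omega>'" using * by simp
  qed
qed

lemma determined_X: "determined t (X j t)"
  unfolding X_def by (rule determined_comp[OF determined_state])

lemma outer_digits_le:
  assumes "r < m"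
  shows "outer_digits (r div 2 ^ e) + 2 ^ (e + 1) \<le> 1 + m"
proof -
  have "m = 2 ^ (e + 1) * 2 ^ (d - e)"
    unfolding power_add[symmetric] using e_le by simp
  moreover have "r div 2 ^ e div 2 < 2 ^ (d - e)"
    using assms calculation less_mult_imp_div_less[of r "2 ^ (d - e)" "2 ^ (e + 1)"]
    by (simp add: div_mult2_eq[symmetric] ac_simps)
  then have "2 ^ (e + 1) * (r div 2 ^ e div 2 + 1) \<le> 2 ^ (e + 1) * 2 ^ (d - e)"
    by (intro mult_left_mono) auto
  ultimately have "2 ^ (e + 1) * (r div 2 ^ e div 2) + 2 ^ (e + 1) \<le> m" by simp
  then show ?thesis unfolding outer_digits_def by linarith
qed

lemma letters_Suc: "letters (Suc t) = pmf_of_set {..<N}"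
  by (simp add: letters_def)

subsection \<open>No collisions\<close>

lemma spin_ne_dvd:
  assumes "i \<noteq> j" "i < 2 ^ e" "j < 2 ^ e"
  shows "\<not> int n dvd spin \<epsilon> i - spin \<epsilon> j"
proof (rule not_dvd_small)
  show "spin \<epsilon> i - spin \<epsilon> j \<noteq> 0" using spin_inj[of \<epsilon> i j] assms(1) by auto
  have "i + j < 2 ^ (e + 1)" using assms(2,3) by simp
  then have "int i + int j < int n" using m_ge m_le_N N_le_n by linarith
  then show "\<bar>spin \<epsilon> i - spin \<epsilon> j\<bar> < int n"
    using spin_bounds[of \<epsilon> i] spin_bounds[of \<epsilon> j] by linarith
qed

lemma pos_inj: "i \<noteq> j \<Longrightarrow> i < 2 ^ e \<Longrightarrow> j < 2 ^ e \<Longrightarrow> pos s i \<noteq> pos s j"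
  using spin_ne_dvd[of i j "snd s"] by (simp add: pos_def nat_mod_eq_iff n_pos)

text \<open>
  The displacement of walker \<open>0\<close> away from walker \<open>j\<close> is \<open>1 + outer_digits f + (2 * \<epsilon> - spin \<epsilon> j)\<close>
  for some \<open>f\<close>, whose last summand is controlled because the same signs \<open>\<epsilon>\<close> occur twice in it. Modulo
  \<open>m + 1\<close> the bounds say that the new distance exceeds \<open>j\<close> on both sides.
\<close>
lemma gap_bounds:
  assumes "r < m" "snd s < 2 ^ e" "j < 2 ^ e"
  shows "int j + 1 \<le> fst (step s r) - (fst s + spin (snd s) j)"
    and "fst (step s r) - (fst s + spin (snd s) j) \<le> int m - int j"
proof -
  let ?o = "bitor (snd s) j"
  have eq: "fst (step s r) - (fst s + spin (snd s) j)
      = 1 + int (outer_digits (r div 2 ^ e)) + (2 * int ?o - int j)"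
    using assms(1) two_times_minus_spin[of "snd s" j] by (simp add: step_def)
  have "j \<le> ?o" using nat_plus_and_or[of "snd s" j] nat_and_le(1)[of "snd s" j] by linarith
  then show "int j + 1 \<le> fst (step s r) - (fst s + spin (snd s) j)" unfolding eq by linarith
  have "?o < 2 ^ e" using assms by (intro nat_or_less)
  moreover have "outer_digits (r div 2 ^ e) + 2 * 2 ^ e \<le> 1 + m" using outer_digits_le[OF assms(1)] by simp
  ultimately have "outer_digits (r div 2 ^ e) + 2 * ?o + 1 \<le> m" by linarith
  then show "fst (step s r) - (fst s + spin (snd s) j) \<le> int m - int j" unfolding eq by linarith
qed

lemma pos_step_ne:
  assumes "r < N" "snd s < 2 ^ e" "i < j" "j < 2 ^ e"
  shows "pos (step s r) i \<noteq> pos s j"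
proof (cases "r < m")
  case True
  have "\<not> int n dvd fst (step s r) + spin (snd (step s r)) i - (fst s + spin (snd s) j)"
    using gap_bounds[OF True assms(2,4)] spin_bounds[of "snd (step s r)" i] assms(3) m_le_N N_le_n
    by (intro not_dvd_small) linarith+
  then show ?thesis by (simp add: pos_def nat_mod_eq_iff n_pos)
next
  case False
  then show ?thesis using assms pos_inj by (simp add: step_def)
qed

lemma AE_letter: "AE \<omega> in W. \<omega> (Suc t) < N"
proof -
  have "AE r in measure_pmf (letters (Suc t)). r < N"
    using N_pos by (subst AE_measure_pmf_iff) (auto simp: letters_def set_pmf_of_set lessThan_empty_iff)
  then show ?thesis unfolding word_space_def
    by (intro AE_PiM_component) (auto simp: measure_pmf.prob_space_axioms)
qed

lemma no_collision:
  "AE \<omega> in W. \<forall>t. \<forall>i<k. \<forall>j<k.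
     (i \<noteq> j \<longrightarrow> X i t \<omega> \<noteq> X j t \<omega>) \<and> (i < j \<longrightarrow> X i (Suc t) \<omega> \<noteq> X j t \<omega>)"
proof -
  have "AE \<omega> in W. \<forall>t. \<omega> (Suc t) < N" using AE_letter by (simp add: AE_all_countable)
  then show ?thesis
  proof eventually_elim
    case (elim \<omega>)
    show ?case
    proof (intro allI impI conjI)
      fix t i j
      assume "i < k" "j < k"
      then have ij: "i < 2 ^ e" "j < 2 ^ e" using k_le by auto
      show "X i t \<omega> \<noteq> X j t \<omega>" if "i \<noteq> j"
        unfolding X_def by (rule pos_inj[OF that ij])
      show "X i (Suc t) \<omega> \<noteq> X j t \<omega>" if "i < j"
        unfolding X_def state.simps using elim by (intro pos_step_ne snd_state that ij) simp
    qed
  qed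
qed

subsection \<open>Each walker is a random walk\<close>

text \<open>
  The possible values of the signs that walker \<open>j\<close> has not used, namely \<open>\<epsilon> - and \<epsilon> j\<close>.
\<close>
definition free_bits :: "nat \<Rightarrow> nat set" where
  "free_bits j = {a. a < 2 ^ e \<and> and a j = 0}"

text \<open>
  The displacement of walker \<open>j\<close>, minus one, when its unused signs are \<open>a\<close> and the letter is \<open>r\<close>. The
  resting letter has code \<open>m\<close>, which is a displacement by \<open>n = m + 1\<close>, that is, by zero.
\<close>
definition code :: "nat \<Rightarrow> nat \<Rightarrow> nat \<Rightarrow> nat" where
  "code j a r = (if r < m then outer_digits (r div 2 ^ e) + 2 * (a + and (r mod 2 ^ e) j) else r)"

definition next_free :: "nat \<Rightarrow> nat \<Rightarrow> nat \<Rightarrow> nat" where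
  "next_free j a r = (if r < m then r mod 2 ^ e - and (r mod 2 ^ e) j else a)"

lemma outer_digits_decode:
  assumes "a < 2 ^ e"
  shows "(outer_digits f + 2 * a) mod 2 = f mod 2" "(outer_digits f + 2 * a) div 2 mod 2 ^ e = a"
    "(outer_digits f + 2 * a) div 2 div 2 ^ e = f div 2"
proof -
  have eq: "outer_digits f + 2 * a = f mod 2 + 2 * (a + 2 ^ e * (f div 2))"
    by (simp add: outer_digits_def)
  have div: "(outer_digits f + 2 * a) div 2 = a + 2 ^ e * (f div 2)" unfolding eq by simp
  show "(outer_digits f + 2 * a) mod 2 = f mod 2"
    unfolding eq by (simp only: mod_mult_self2 mod_mod_trivial)
  show "(outer_digits f + 2 * a) div 2 mod 2 ^ e = a" unfolding div using assms by simp
  show "(outer_digits f + 2 * a) div 2 div 2 ^ e = f div 2" unfolding div using assms by simp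
qed

lemma mix_bits:
  assumes "a \<in> free_bits j" "\<epsilon> < 2 ^ e"
  shows "a + and \<epsilon> j < 2 ^ e" "and (a + and \<epsilon> j) j = and \<epsilon> j"
proof -
  have *: "and a j = 0" "and (and \<epsilon> j) j = and \<epsilon> j"
    using assms(1) by (simp_all add: free_bits_def and.assoc)
  show "and (a + and \<epsilon> j) j = and \<epsilon> j" by (rule disjoint_parts(2)[OF *])
  have "bitor a (and \<epsilon> j) < 2 ^ e"
    using assms nat_and_le(1)[of \<epsilon> j] by (intro nat_or_less) (auto simp: free_bits_def)
  then show "a + and \<epsilon> j < 2 ^ e" by (simp add: disjoint_parts(1)[OF *])
qed

lemma diff_and_free: "\<epsilon> < 2 ^ e \<Longrightarrow> \<epsilon> - and \<epsilon> j \<in> free_bits j"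
  by (simp add: free_bits_def and_diff_and)

lemma code_less:
  assumes "a \<in> free_bits j" "r < N"
  shows "code j a r < N"
proof (cases "r < m")
  case True
  have "a + and (r mod 2 ^ e) j < 2 ^ e" using assms(1) by (intro mix_bits) simp_all
  then have "code j a r < m" using outer_digits_le[OF True] True by (simp add: code_def)
  then show ?thesis using m_le_N by linarith
qed (use assms(2) in \<open>simp add: code_def\<close>)

text \<open>
  The code shows the outer digits and, in the positions between, the old unused signs merged with the
  new used ones. The two kinds sit at complementary digits, so they can be separated, and the new
  unused signs complete the letter.
\<close>
lemma code_inj: "inj_on (\<lambda>(a, r). (code j a r, next_free j a r)) (free_bits j \<times> {..<N})"
proof (rule inj_onI, clarsimp)
  fix a r a' r'
  assume a: "a \<in> free_bits j" "a' \<in> free_bits j" and r: "r < N" "r' < N"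
    and c: "code j a r = code j a' r'" and f: "next_free j a r = next_free j a' r'"
  have less: "code j a r < m \<longleftrightarrow> r < m" if "a \<in> free_bits j" for a r
  proof (cases "r < m")
    case True
    have "a + and (r mod 2 ^ e) j < 2 ^ e" using that by (intro mix_bits) simp_all
    then show ?thesis using outer_digits_le[OF True] True by (simp add: code_def)
  qed (simp add: code_def)
  show "a = a' \<and> r = r'"
  proof (cases "r < m")
    case True
    then have True': "r' < m" using less a c by metis
    let ?x = "a + and (r mod 2 ^ e) j" and ?x' = "a' + and (r' mod 2 ^ e) j"
    have c': "outer_digits (r div 2 ^ e) + 2 * ?x = outer_digits (r' div 2 ^ e) + 2 * ?x'"
      using c True True' by (simp add: code_def)
    have x: "?x < 2 ^ e" "?x' < 2 ^ e" using a by (intro mix_bits; simp)+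
    have xx: "?x = ?x'" using outer_digits_decode(2)[OF x(1)] outer_digits_decode(2)[OF x(2)] c' by metis
    have "r div 2 ^ e mod 2 = r' div 2 ^ e mod 2"
      using outer_digits_decode(1)[OF x(1)] outer_digits_decode(1)[OF x(2)] c' by metis
    moreover have "r div 2 ^ e div 2 = r' div 2 ^ e div 2"
      using outer_digits_decode(3)[OF x(1)] outer_digits_decode(3)[OF x(2)] c' by metis
    ultimately have hi: "r div 2 ^ e = r' div 2 ^ e" by (metis div_mult_mod_eq)
    have low: "and (r mod 2 ^ e) j = and (r' mod 2 ^ e) j"
      using mix_bits(2)[OF a(1), of "r mod 2 ^ e"] mix_bits(2)[OF a(2), of "r' mod 2 ^ e"] xx by simp
    then have "a = a'" using xx by simp
    moreover have "r mod 2 ^ e = r' mod 2 ^ e"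
      using f low True True' nat_and_le(1)[of "r mod 2 ^ e" j] nat_and_le(1)[of "r' mod 2 ^ e" j]
      by (simp add: next_free_def)
    ultimately show ?thesis using hi by (metis div_mult_mod_eq)
  next
    case False
    then have "\<not> r' < m" using less a c by metis
    then show ?thesis using False c f by (simp add: code_def next_free_def)
  qed
qed

lemma finite_free_bits: "finite (free_bits j)"
  by (rule finite_subset[of _ "{..<2 ^ e}"]) (auto simp: free_bits_def)

lemma code_bij:
  "bij_betw (\<lambda>(a, r). (code j a r, next_free j a r)) (free_bits j \<times> {..<N}) ({..<N} \<times> free_bits j)"
proof -
  let ?f = "\<lambda>(a, r). (code j a r, next_free j a r)"
  have "?f ` (free_bits j \<times> {..<N}) \<subseteq> {..<N} \<times> free_bits j"
    by (auto simp: code_less) (auto simp: next_free_def diff_and_free)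
  moreover have "card (?f ` (free_bits j \<times> {..<N})) = card ({..<N} \<times> free_bits j)"
    by (subst card_image[OF code_inj]) (simp add: card_cartesian_product)
  ultimately have "?f ` (free_bits j \<times> {..<N}) = {..<N} \<times> free_bits j"
    by (intro card_subset_eq) (simp_all add: finite_free_bits)
  with code_inj show ?thesis by (simp add: bij_betw_def)
qed

lemma E_image: "y < n \<Longrightarrow> E `` {y} = (if N = n then {..<n} else {..<n} - {y})"
  by (auto simp: E_def complete_edges_def complete_loop_edges_def)

lemma card_E: "y < n \<Longrightarrow> card (E `` {y}) = N"
  using sizes by (auto simp: E_image)

lemma move_bij:
  assumes y: "y < n"
  shows "bij_betw (\<lambda>c. nat ((int y + 1 + int c) mod int n)) {..<N} (E `` {y})" (is "bij_betw ?f _ _")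
proof -
  have inj: "inj_on ?f {..<N}"
  proof (rule inj_onI, rule ccontr)
    fix c c' assume *: "c \<in> {..<N}" "c' \<in> {..<N}" "?f c = ?f c'" "c \<noteq> c'"
    then have "int n dvd int c - int c'" by (simp add: nat_mod_eq_iff n_pos)
    moreover have "int c - int c' \<noteq> 0" "\<bar>int c - int c'\<bar> < int n" using *(1,2,4) N_le_n by auto
    ultimately show False using not_dvd_small by blast
  qed
  have "?f c \<noteq> y" if "c < N" "N \<noteq> n" for c
  proof -
    have "\<not> int n dvd (int y + 1 + int c) - int y"
      using that N_le_n by (intro not_dvd_small) auto
    then have "?f c \<noteq> nat (int y mod int n)" by (subst nat_mod_eq_iff[OF n_pos])
    then show ?thesis using y by simp
  qed
  moreover have "?f c < n" for c using n_pos by (simp add: nat_less_iff)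
  ultimately have "?f ` {..<N} \<subseteq> E `` {y}" by (auto simp: E_image[OF y])
  moreover have "card (?f ` {..<N}) = card (E `` {y})"
    by (simp add: card_image[OF inj] card_E[OF y])
  moreover have "finite (E `` {y})" by (simp add: E_image[OF y])
  ultimately have "?f ` {..<N} = E `` {y}" by (intro card_subset_eq)
  with inj show ?thesis by (simp add: bij_betw_def)
qed

lemma X_0_spin: "X j 0 \<omega> = nat (spin (\<omega> 0 mod 2 ^ e) j mod int n)"
  by (simp add: X_def pos_def)

text \<open>
  When the flock moves, the displacement of walker \<open>j\<close> is
  \<open>1 + outer_digits f + 2 * \<epsilon> + spin \<epsilon>' j - spin \<epsilon> j\<close>. The terms \<open>int j\<close> of the two spins cancel and leave
  \<open>2 * (\<epsilon> - and \<epsilon> j + and \<epsilon>' j)\<close>, where the signs of \<open>\<epsilon>\<close> are replaced by those of \<open>\<epsilon>'\<close> exactly at the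
  digits of \<open>j\<close>.
\<close>
lemma X_Suc_code:
  assumes "\<omega> (Suc t) < N"
  defines "\<epsilon> \<equiv> snd (state t \<omega>)"
  shows "X j (Suc t) \<omega> = nat ((int (X j t \<omega>) + 1 + int (code j (\<epsilon> - and \<epsilon> j) (\<omega> (Suc t)))) mod int n)"
    (is "?l = ?r")
proof -
  obtain x where s: "state t \<omega> = (x, \<epsilon>)" using \<epsilon>_def by (metis prod.collapse)
  let ?r = "\<omega> (Suc t)" and ?y = "x + spin \<epsilon> j"
  have X: "int (X j t \<omega>) = ?y mod int n" using n_pos by (simp add: X_def pos_def s)
  have rhs: "nat ((int (X j t \<omega>) + 1 + int c) mod int n) = nat ((?y + 1 + int c) mod int n)" for c
    unfolding X by (simp only: add.assoc[of _ 1] mod_add_left_eq)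
  show ?thesis
  proof (cases "?r < m")
    case True
    have "2 * int \<epsilon> - spin \<epsilon> j + spin (?r mod 2 ^ e) j
      = 2 * int (\<epsilon> - and \<epsilon> j + and (?r mod 2 ^ e) j)"
      using nat_and_le(1)[of \<epsilon> j] by (simp add: spin_def of_nat_diff)
    then have "x + 1 + int (outer_digits (?r div 2 ^ e)) + 2 * int \<epsilon> + spin (?r mod 2 ^ e) j
      = ?y + 1 + int (outer_digits (?r div 2 ^ e) + 2 * (\<epsilon> - and \<epsilon> j + and (?r mod 2 ^ e) j))"
      by linarith
    then show ?thesis
      unfolding rhs
      by (simp only: X_def pos_def state.simps s step_def code_def True if_True fst_conv snd_conv)
  next
    case False
    then have nm: "n = m + 1" "?r = m" using assms(1) sizes by auto
    have "?y - (?y + 1 + int ?r) = - int n" using nm by simp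
    then have "int n dvd ?y - (?y + 1 + int ?r)" by (simp only: dvd_minus_iff dvd_refl)
    have "X j (Suc t) \<omega> = nat (?y mod int n)"
      using False by (simp add: X_def pos_def s step_def)
    also have "\<dots> = nat ((?y + 1 + int ?r) mod int n)"
      by (subst nat_mod_eq_iff[OF n_pos]) fact
    also have "?r = code j (\<epsilon> - and \<epsilon> j) ?r" using False by (simp add: code_def)
    finally show ?thesis unfolding rhs .
  qed
qed

text \<open>
  Flipping the signs in which \<open>a\<close> and \<open>a'\<close> differ maps the one event to the other, preserves the
  uniform distribution of the first letter, and does not move walker \<open>j\<close>.
\<close>
lemma initial_free_bits_uniform:
  assumes a: "a \<in> free_bits j" "a' \<in> free_bits j"
  shows "measure W {\<omega>. X j 0 \<omega> = y \<and> snd (state 0 \<omega>) - and (snd (state 0 \<omega>)) j = a}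
       = measure W {\<omega>. X j 0 \<omega> = y \<and> snd (state 0 \<omega>) - and (snd (state 0 \<omega>)) j = a'}"
proof -
  define Q where "Q a \<epsilon> \<longleftrightarrow> nat (spin \<epsilon> j mod int n) = y \<and> \<epsilon> - and \<epsilon> j = a" for a \<epsilon>
  have eq: "measure W {\<omega>. X j 0 \<omega> = y \<and> snd (state 0 \<omega>) - and (snd (state 0 \<omega>)) j = a}
    = (\<Sum>r<2 ^ e. measure W {\<omega>. Q a r}) / real (2 ^ e)" for a
  proof -
    have "measure W {\<omega>. X j 0 \<omega> = y \<and> snd (state 0 \<omega>) - and (snd (state 0 \<omega>)) j = a}
      = measure W {\<omega>. Q a (\<omega> 0 mod 2 ^ e)}" by (simp add: Q_def X_0_spin)
    also have "\<dots> = (\<Sum>r<2 ^ e. measure W {\<omega>. Q a ((fun_upd \<omega> 0 r) 0 mod 2 ^ e)}) / real (2 ^ e)"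
      by (rule prob_resample[where t = 0]) (auto simp: determined_def letters_def)
    finally show ?thesis by simp
  qed
  let ?u = "xor a a'"
  have u: "and ?u j = 0" and u_less: "?u < 2 ^ e"
    using a by (auto simp: free_bits_def bit_eq_iff bit_simps intro: nat_xor_less)
  have "Q a' (xor r ?u) \<longleftrightarrow> Q a r" for r
  proof -
    have "xor z ?u = a' \<longleftrightarrow> z = a" for z
      by (metis bit.xor_self xor.assoc xor.commute xor.left_neutral xor_self_eq)
    then show ?thesis
      unfolding Q_def xor_free(2)[OF u] by (simp add: xor_free(1)[OF u] spin_def)
  qed
  then have "(\<Sum>r<2 ^ e. measure W {\<omega>. Q a r}) = (\<Sum>r<2 ^ e. measure W {\<omega>. Q a' r})"
    using u_less
    by (intro sum.reindex_bij_witness[where i = "\<lambda>r. xor r ?u" and j = "\<lambda>r. xor r ?u"])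
       (auto simp: nat_xor_less xor.assoc)
  then show ?thesis unfolding eq by simp
qed

lemma random_walk_X: "random_walk W V E (X j)"
proof (rule random_walk_hidden_state[where b = N and H = "free_bits j" and
      h = "\<lambda>t \<omega>. snd (state t \<omega>) - and (snd (state t \<omega>)) j" and
      g = "\<lambda>y a r. (nat ((int y + 1 + int (code j a r)) mod int n), next_free j a r)"])
  show "letters (Suc t) = pmf_of_set {..<N}" for t by (rule letters_Suc)
  show "0 < N" by (rule N_pos)
  show "determined t (X j t)" for t by (rule determined_X)
  show "determined t (\<lambda>\<omega>. snd (state t \<omega>) - and (snd (state t \<omega>)) j)" for t
    by (rule determined_comp[OF determined_state])
  show "X j t \<omega> \<in> V" for t \<omega> by (simp add: X_def pos_less complete_verts_def)
  show "snd (state t \<omega>) - and (snd (state t \<omega>)) j \<in> free_bits j" for t \<omega>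
    by (rule diff_and_free[OF snd_state])
  show "finite (free_bits j)" by (rule finite_free_bits)
next
  fix t and \<omega> :: "nat \<Rightarrow> nat"
  assume "\<omega> (Suc t) < N"
  then show "(X j (Suc t) \<omega>, snd (state (Suc t) \<omega>) - and (snd (state (Suc t) \<omega>)) j) =
     (nat ((int (X j t \<omega>) + 1 + int (code j (snd (state t \<omega>) - and (snd (state t \<omega>)) j) (\<omega> (Suc t)))) mod int n),
      next_free j (snd (state t \<omega>) - and (snd (state t \<omega>)) j) (\<omega> (Suc t)))"
    by (subst X_Suc_code) (auto simp: next_free_def step_def)
next
  fix y assume "y \<in> V"
  then have y: "y < n" by (simp add: complete_verts_def)
  have "bij_betw (map_prod (\<lambda>c. nat ((int y + 1 + int c) mod int n)) id)
    ({..<N} \<times> free_bits j) (E `` {y} \<times> free_bits j)"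
    by (intro bij_betw_map_prod move_bij[OF y] bij_betw_id)
  from bij_betw_trans[OF code_bij this]
  show "bij_betw (\<lambda>(a, r). (nat ((int y + 1 + int (code j a r)) mod int n), next_free j a r))
    (free_bits j \<times> {..<N}) (E `` {y} \<times> free_bits j)"
    by (simp add: comp_def case_prod_unfold map_prod_def)
next
  fix y a a' assume "a \<in> free_bits j" "a' \<in> free_bits j"
  then show "measure W {\<omega>. X j 0 \<omega> = y \<and> snd (state 0 \<omega>) - and (snd (state 0 \<omega>)) j = a}
       = measure W {\<omega>. X j 0 \<omega> = y \<and> snd (state 0 \<omega>) - and (snd (state 0 \<omega>)) j = a'}"
    by (rule initial_free_bits_uniform)
qed

lemma avoidance_coupling_X: "avoidance_coupling W V E k X"
  using random_walk_X no_collision prob_space_word_space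
  by (simp add: avoidance_coupling_def coupling_def)

subsection \<open>The entropy rate of one walker and of all walkers\<close>

text \<open>
  The lower bound on the entropy comes from walker \<open>0\<close> alone, whose \<open>T\<close> moves have \<open>N\<close> equally likely
  outcomes each. The upper bound comes from the \<open>2 ^ e * N ^ T\<close> words of letters that determine all
  walkers up to time \<open>T\<close>; replacing \<open>2 ^ e\<close> by \<open>N\<close> costs nothing in the limit.
\<close>
lemma entropy_X:
  assumes J: "finite J" "0 \<in> J"
  shows "shannon_entropy W (\<lambda>\<omega>. \<lambda>(j, t)\<in>J \<times> {..T}. X j t \<omega>)
           \<in> {real T * log 2 (real N)..real (Suc T) * log 2 (real N)}"
proof (rule shannon_entropy_bounds[OF prob_space_word_space])
  let ?Y = "\<lambda>\<omega>. \<lambda>(j, t)\<in>J \<times> {..T}. X j t \<omega>"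
  have det: "determined T ?Y"
    unfolding determined_def
  proof (intro allI impI)
    fix \<omega> \<omega>' :: "nat \<Rightarrow> nat" assume "\<forall>s\<le>T. \<omega> s = \<omega>' s"
    then have "X j t \<omega> = X j t \<omega>'" if "t \<le> T" for j t
      using determined_mono[OF determined_X that] unfolding determined_def by blast
    then show "?Y \<omega> = ?Y \<omega>'" by (auto simp: restrict_def)
  qed
  then show "?Y \<in> measurable W (count_space UNIV)" by (rule measurable_determined)
  have "?Y ` space W \<subseteq> (J \<times> {..T}) \<rightarrow>\<^sub>E {..<n}"
    by (simp add: image_subset_iff PiE_iff X_def pos_less)
  then show "finite (?Y ` space W)"
    by (rule finite_subset) (use J in \<open>simp add: finite_PiE\<close>)
  have powr: "2 powr (- (real c * log 2 (real N))) = (1 / real N) ^ c" for c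
  proof -
    have "2 powr (- (real c * log 2 (real N))) = (2 powr log 2 (real N)) powr (- real c)"
      by (simp add: powr_powr mult.commute)
    also have "2 powr log 2 (real N) = real N" using N_pos by (intro powr_log_cancel) auto
    also have "real N powr (- real c) = (1 / real N) ^ c"
      using N_pos by (simp add: powr_minus powr_realpow power_divide inverse_eq_divide)
    finally show ?thesis .
  qed
  fix y
  show "measure W {\<omega> \<in> space W. ?Y \<omega> = y} \<le> 2 powr (- (real T * log 2 (real N)))"
  proof -
    interpret prob_space W by (rule prob_space_word_space)
    have "prob {\<omega> \<in> space W. ?Y \<omega> = y} \<le> prob {\<omega> \<in> space W. \<forall>s\<le>T. X 0 s \<omega> = y (0, s)}"
    proof (rule finite_measure_mono)
      show "{\<omega> \<in> space W. ?Y \<omega> = y} \<subseteq> {\<omega> \<in> space W. \<forall>s\<le>T. X 0 s \<omega> = y (0, s)}"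
        using J by auto
      show "{\<omega> \<in> space W. \<forall>s\<le>T. X 0 s \<omega> = y (0, s)} \<in> events"
        using sets_determined[OF determined_past[OF determined_X]] by simp
    qed
    also have "\<dots> \<le> (1 / real N) ^ T"
      by (rule random_walk_trajectory_prob_le[OF random_walk_X])
         (simp add: card_E complete_verts_def)
    finally show ?thesis unfolding powr .
  qed
  assume nz: "measure W {\<omega> \<in> space W. ?Y \<omega> = y} \<noteq> 0"
  define D :: nat where "D = (\<Prod>s\<le>T. case s of 0 \<Rightarrow> 2 ^ e | Suc _ \<Rightarrow> N)"
  have "\<exists>c::nat. measure W {\<omega>. ?Y \<omega> = y} = real c / real D"
    unfolding D_def
    by (rule prob_granular[OF _ _ determined_comp[OF det]]) (auto simp: letters_def N_pos split: nat.split)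
  then obtain c :: nat where c:
    "measure W {\<omega>. ?Y \<omega> = y} = real c / real D" ..
  then have "c \<noteq> 0" using nz by (intro notI) simp
  have "(2::nat) ^ e \<le> 2 ^ (e + 1)" by simp
  then have "(2::nat) ^ e \<le> N" using m_ge m_le_N by linarith
  then have "D \<le> (\<Prod>s\<le>T. N)"
    unfolding D_def by (intro prod_mono) (auto split: nat.split)
  then have "real D \<le> real N ^ Suc T"
    by (simp only: of_nat_le_iff prod_constant card_atMost flip: of_nat_power)
  moreover have "0 < D"
    unfolding D_def using N_pos by (intro prod_pos) (auto split: nat.split)
  ultimately have "1 / real N ^ Suc T \<le> real c / real D"
    using \<open>c \<noteq> 0\<close> by (intro frac_le) auto
  then show "2 powr (- (real (Suc T) * log 2 (real N))) \<le> measure W {\<omega> \<in> space W. ?Y \<omega> = y}"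
    unfolding powr using c by (simp add: power_one_over)
qed

lemma entropy_rate_X:
  assumes "finite J" "0 \<in> J"
  shows "has_entropy_rate W J X (log 2 (real N))"
  unfolding has_entropy_rate_def
proof (rule tendsto_sandwich)
  let ?L = "log 2 (real N)"
  let ?H = "\<lambda>T. shannon_entropy W (\<lambda>\<omega>. \<lambda>(j, t)\<in>J \<times> {..T}. X j t \<omega>)"
  note H = entropy_X[OF assms]
  show "\<forall>\<^sub>F T in sequentially. ?L \<le> ?H T / real T"
    by (rule eventually_mono[OF eventually_gt_at_top[of 0]])
       (use H in \<open>auto simp: pos_le_divide_eq mult.commute\<close>)
  show "\<forall>\<^sub>F T in sequentially. ?H T / real T \<le> ?L + ?L / real T"
    by (rule eventually_mono[OF eventually_gt_at_top[of 0]])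
       (use H in \<open>auto simp: field_simps\<close>)
  show "(\<lambda>T. ?L) \<longlonglongrightarrow> ?L" by simp
  have "(\<lambda>T. ?L + ?L / real T) \<longlonglongrightarrow> ?L + 0"
    by (intro tendsto_add tendsto_const lim_const_over_n)
  then show "(\<lambda>T. ?L + ?L / real T) \<longlonglongrightarrow> ?L" by simp
qed

lemma minimum_entropy_X: "minimum_entropy W k X"
  unfolding minimum_entropy_def using entropy_rate_X[of "{..<k}"] entropy_rate_X[of "{0}"] k_pos by auto

subsection \<open>The Markov property\<close>

definition read_signs :: "(nat \<Rightarrow> nat) \<Rightarrow> nat" where
  "read_signs c = (THE \<epsilon>. \<epsilon> < 2 ^ e \<and> (\<forall>i<k. c i = nat ((int (c 0) + spin \<epsilon> i) mod int n)))"

text \<open>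
  The criterion by which walker \<open>j > 0\<close> recognises, at its turn, that walker \<open>0\<close> has stayed in place:
  its cyclic distance to walker \<open>0\<close> is at most \<open>j\<close>. For \<open>N = m\<close> the flock never rests, but for \<open>n = m\<close> the
  distance after a move can be equal to \<open>j\<close>, whence the first condition.
\<close>
definition rests :: "nat \<Rightarrow> (nat \<Rightarrow> nat) \<Rightarrow> bool" where
  "rests j c \<longleftrightarrow> N = m + 1 \<and> (\<exists>z. \<bar>z\<bar> \<le> int j \<and> int n dvd int (c j) - int (c 0) - z)"

text \<open>
  Walker \<open>0\<close> knows the signs of the formation and draws a letter. Walker \<open>2 ^ b\<close> tosses a coin for the
  side of walker \<open>0\<close> on which it settles. Any other \<open>j\<close> is a sum \<open>2 ^ b + i\<close> with \<open>0 < i < 2 ^ b\<close>, and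
  walker \<open>j\<close> completes a parallelogram with the walkers \<open>0\<close>, \<open>2 ^ b\<close> and \<open>i\<close>.
\<close>
definition kernel :: "nat \<Rightarrow> (nat \<Rightarrow> nat) \<Rightarrow> nat pmf" where
  "kernel j c =
    (if j = 0 then map_pmf (\<lambda>r. pos (step (int (c 0), read_signs c) r) 0) (pmf_of_set {..<N})
     else if rests j c then return_pmf (c j)
     else if \<exists>b. j = 2 ^ b
       then map_pmf (\<lambda>s. nat ((int (c 0) + (if s then int j else - int j)) mod int n)) (pmf_of_set UNIV)
     else return_pmf (let b = floor_log j in
            nat ((int (c (2 ^ b)) + int (c (j - 2 ^ b)) - int (c 0)) mod int n)))"

lemma pos_cong: "int n dvd x - int (pos (x, \<epsilon>) 0)"
  using n_pos by (simp add: pos_def flip: mod_eq_dvd_iff)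

lemma int_pos: "int (pos s j) = (fst s + spin (snd s) j) mod int n"
  using n_pos by (simp add: pos_def)

text \<open>
  Formations can be described from the visible location of walker \<open>0\<close>, although the state stores an
  integer that is only determined modulo \<open>n\<close> by it.
\<close>
lemma pos_anchor: "pos s j = nat ((int (pos s 0) + spin (snd s) j) mod int n)"
  unfolding int_pos by (simp add: pos_def mod_simps)

lemma exp_less_n: "b < e \<Longrightarrow> (2::nat) * 2 ^ b < n"
proof -
  assume "b < e"
  then have "(2::nat) ^ Suc b \<le> 2 ^ e" by (intro power_increasing) auto
  moreover have "(2::nat) ^ e < 2 ^ (e + 1)" by simp
  ultimately show ?thesis using m_ge m_le_N N_le_n unfolding power_Suc by linarith
qed

text \<open>
  The sign at digit \<open>b\<close> is seen from walker \<open>2 ^ b < k\<close>, whose two possible places differ by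
  \<open>2 ^ (b + 1) < n\<close>.
\<close>
lemma signs_unique:
  assumes less: "\<epsilon> < 2 ^ e" "\<epsilon>' < 2 ^ e"
    and dvd: "\<And>i. i < k \<Longrightarrow> int n dvd spin \<epsilon> i - spin \<epsilon>' i"
  shows "\<epsilon> = \<epsilon>'"
proof (rule bit_eqI)
  fix b
  show "bit \<epsilon> b = bit \<epsilon>' b"
  proof (cases "b < e")
    case True
    have "int n dvd spin \<epsilon> (2 ^ b) - spin \<epsilon>' (2 ^ b)" by (rule dvd[OF k_gt[OF True]])
    moreover have "\<bar>spin \<epsilon> (2 ^ b) - spin \<epsilon>' (2 ^ b)\<bar> < int n"
      using exp_less_n[OF True] spin_bounds[of \<epsilon> "2 ^ b"] spin_bounds[of \<epsilon>' "2 ^ b"] by linarith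
    ultimately have "spin \<epsilon> (2 ^ b) - spin \<epsilon>' (2 ^ b) = 0" using not_dvd_small by blast
    then show ?thesis by (simp add: spin_power split: if_splits)
  next
    case False
    then have "\<not> bit \<epsilon> b" "\<not> bit \<epsilon>' b"
      using less by (metis bit_take_bit_iff take_bit_nat_eq_self)+
    then show ?thesis by simp
  qed
qed

lemma read_signs_formation:
  assumes "snd s < 2 ^ e" "\<And>i. i < k \<Longrightarrow> c i = pos s i"
  shows "read_signs c = snd s"
  unfolding read_signs_def
proof (rule the_equality)
  have c0: "c 0 = pos s 0" using assms(2) k_pos by simp
  show "snd s < 2 ^ e \<and> (\<forall>i<k. c i = nat ((int (c 0) + spin (snd s) i) mod int n))"
  proof (intro conjI allI impI assms(1))
    fix i assume "i < k"
    show "c i = nat ((int (c 0) + spin (snd s) i) mod int n)"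
      unfolding c0 assms(2)[OF \<open>i < k\<close>] by (rule pos_anchor)
  qed
  fix \<epsilon> assume *: "\<epsilon> < 2 ^ e \<and> (\<forall>i<k. c i = nat ((int (c 0) + spin \<epsilon> i) mod int n))"
  show "\<epsilon> = snd s"
  proof (rule signs_unique)
    fix i assume "i < k"
    then have "c i = nat ((int (c 0) + spin \<epsilon> i) mod int n)" using * by blast
    moreover have "c i = nat ((int (c 0) + spin (snd s) i) mod int n)"
      unfolding c0 assms(2)[OF \<open>i < k\<close>] by (rule pos_anchor)
    ultimately have "nat ((int (c 0) + spin \<epsilon> i) mod int n) = nat ((int (c 0) + spin (snd s) i) mod int n)"
      by (rule trans[OF sym])
    then show "int n dvd spin \<epsilon> i - spin (snd s) i" by (simp add: nat_mod_eq_iff n_pos)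
  qed (use * assms(1) in blast)+
qed

lemma pos_step_cong:
  assumes "int n dvd x - x'"
  shows "pos (step (x, \<epsilon>) r) j = pos (step (x', \<epsilon>) r) j"
  using assms by (simp add: pos_def step_def nat_mod_eq_iff n_pos)

text \<open>
  If the flock rests, walker \<open>j\<close> is still at offset \<open>spin \<epsilon> j\<close>, which is at most \<open>j\<close> in absolute value.
  Otherwise \<open>gap_bounds\<close> keeps the offset away from this range modulo \<open>m + 1\<close>.
\<close>
lemma rests_iff:
  assumes "r < N" "snd s < 2 ^ e" "j < 2 ^ e" "c j = pos s j" "c 0 = pos (step s r) 0"
  shows "rests j c \<longleftrightarrow> \<not> r < m"
proof
  have diff: "int n dvd int (c j) - int (c 0) - z \<longleftrightarrow>
      int n dvd fst s + spin (snd s) j - fst (step s r) - z" for z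
    unfolding assms(4,5) int_pos mod_eq_dvd_iff[symmetric] spin_0 by (simp add: mod_simps)
  show "\<not> r < m" if "rests j c"
  proof
    assume r: "r < m"
    from that obtain z where z: "N = m + 1" "\<bar>z\<bar> \<le> int j" "int n dvd fst s + spin (snd s) j - fst (step s r) - z"
      unfolding rests_def diff by auto
    have "n = m + 1" using z(1) sizes by auto
    then have "fst s + spin (snd s) j - fst (step s r) - z \<noteq> 0"
      "\<bar>fst s + spin (snd s) j - fst (step s r) - z\<bar> < int n"
      using gap_bounds[OF r assms(2,3)] z(2) by linarith+
    then show False using z(3) not_dvd_small by blast
  qed
  show "rests j c" if "\<not> r < m"
    unfolding rests_def diff
  proof (intro conjI exI[of _ "spin (snd s) j"])
    show "N = m + 1" using that assms(1) N_le by linarith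
  qed (use spin_bounds that in \<open>simp_all add: step_def\<close>)
qed

text \<open>
  Spins add up over disjoint sets of digits.
\<close>
lemma follow_composite:
  assumes "j \<noteq> 0" "c (2 ^ b) = pos s (2 ^ b)" "c (j - 2 ^ b) = pos s (j - 2 ^ b)" "c 0 = pos s 0"
    "b = floor_log j"
  shows "pos s j = nat ((int (c (2 ^ b)) + int (c (j - 2 ^ b)) - int (c 0)) mod int n)"
proof -
  have j: "2 ^ b \<le> j" "j < 2 * 2 ^ b"
    using assms(1,5) floor_log_exp2_le[of j] floor_log_exp2_gt[of j] by auto
  have "spin (snd s) j = spin (snd s) (2 ^ b) + spin (snd s) (j - 2 ^ b)"
    using spin_add[of "j - 2 ^ b" b "snd s"] j by simp
  then have "fst s + spin (snd s) j
      = (fst s + spin (snd s) (2 ^ b)) + (fst s + spin (snd s) (j - 2 ^ b)) - (fst s + spin (snd s) 0)"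
    by simp
  then show ?thesis
    unfolding assms(2-4) int_pos mod_diff_cong[OF mod_add_eq mod_mod_trivial] by (simp only: pos_def)
qed

lemma past_iff:
  assumes "j < k"
  shows "same_past k j t (\<lambda>i s. X i s \<omega>) x \<longleftrightarrow>
    (\<forall>i<k. \<forall>s\<le>t. X i s \<omega> = x i s) \<and> (\<forall>i<j. X i (Suc t) \<omega> = x i (Suc t))"
  using assms unfolding same_past_def last_time_def
  by (auto simp: le_Suc_eq)

lemma locations:
  assumes "same_past k j t (\<lambda>i s. X i s \<omega>) x" "i < k"
  shows "current_locations k j t x i = (if i < j then pos (state (Suc t) \<omega>) i else pos (state t \<omega>) i)"
proof -
  have "X i (last_time j t i) \<omega> = x i (last_time j t i)"
    using assms unfolding same_past_def by blast
  then show ?thesis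
    using assms(2) by (simp add: current_locations_def last_time_def X_def del: state.simps split: if_splits)
qed

lemma determined_same_past: "determined (Suc t) (\<lambda>\<omega>. same_past k j t (\<lambda>i s. X i s \<omega>) x)"
  unfolding determined_def
proof (intro allI impI)
  fix \<omega> \<omega>' :: "nat \<Rightarrow> nat" assume *: "\<forall>s\<le>Suc t. \<omega> s = \<omega>' s"
  have "X i s \<omega> = X i s \<omega>'" if "s \<le> last_time j t i" for i s
  proof -
    have "s \<le> Suc t" using that by (simp add: last_time_def split: if_splits)
    then show ?thesis using determined_X[of s i] * unfolding determined_def by simp
  qed
  then show "same_past k j t (\<lambda>i s. X i s \<omega>) x = same_past k j t (\<lambda>i s. X i s \<omega>') x"
    by (simp add: same_past_def)
qed

text \<open>
  The fresh sign at digit \<open>b\<close> is invisible until walker \<open>2 ^ b\<close> moves.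
\<close>
lemma step_flip_bit:
  assumes b: "b < e" and i: "i < 2 ^ b" and r: "r < m"
  shows "pos (step s (xor r (2 ^ b))) i = pos (step s r) i"
proof -
  have r': "xor r (2 ^ b) < m"
    using r b e_le by (intro nat_xor_less power_strict_increasing) auto
  have hi: "xor r (2 ^ b) div 2 ^ e = r div 2 ^ e"
    by (rule bit_eqI) (use b in \<open>auto simp: bit_simps simp flip: drop_bit_eq_div\<close>)
  have i_bits: "\<not> bit i b" using i by (metis bit_take_bit_iff less_irrefl take_bit_nat_eq_self)
  have "and (xor r (2 ^ b) mod 2 ^ e) i = and (r mod 2 ^ e) i"
    by (rule bit_eqI) (use i_bits in \<open>auto simp: bit_simps simp flip: take_bit_eq_mod\<close>)
  then show ?thesis using r r' by (simp add: pos_def step_def hi spin_def)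
qed

text \<open>
  The past up to the turn of walker \<open>0\<close> is a function of the letters up to time \<open>t\<close>, and it fixes the
  signs. The next location is therefore a fixed function of the independent letter at time \<open>t + 1\<close>.
\<close>
lemma kernel_first_walker:
  assumes A: "\<And>\<omega>. A \<omega> \<longleftrightarrow> same_past k 0 t (\<lambda>i s. X i s \<omega>) x"
  shows "measure W {\<omega>. X 0 (Suc t) \<omega> = v \<and> A \<omega>}
    = pmf (kernel 0 (current_locations k 0 t x)) v * measure W {\<omega>. A \<omega>}"
proof -
  define c where "c = current_locations k 0 t x"
  define f where "f r = pos (step (int (c 0), read_signs c) r) 0" for r
  have det: "determined t A"
    unfolding determined_def
  proof (intro allI impI)
    fix \<omega> \<omega>' :: "nat \<Rightarrow> nat" assume *: "\<forall>s\<le>t. \<omega> s = \<omega>' s"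
    have "X i s \<omega> = X i s \<omega>'" if "s \<le> t" for i s
      using that determined_X[of s i] * unfolding determined_def by simp
    then show "A \<omega> = A \<omega>'" by (simp add: A same_past_def last_time_def)
  qed
  have X_f: "X 0 (Suc t) \<omega> = f (\<omega> (Suc t))" if "A \<omega>" for \<omega>
  proof -
    have c: "c i = pos (state t \<omega>) i" if "i < k" for i
      using locations[of 0 t \<omega> x i] \<open>A \<omega>\<close> that by (simp add: c_def A)
    have "read_signs c = snd (state t \<omega>)" by (rule read_signs_formation[OF snd_state c])
    moreover have "int n dvd int (c 0) - fst (state t \<omega>)"
      using c k_pos pos_cong[of "fst (state t \<omega>)" "snd (state t \<omega>)"] by (simp add: dvd_diff_commute)
    ultimately show ?thesis
      using pos_step_cong[of "int (c 0)" "fst (state t \<omega>)" "snd (state t \<omega>)" "\<omega> (Suc t)" 0]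
      by (simp add: X_def f_def)
  qed
  have "measure W {\<omega>. X 0 (Suc t) \<omega> = v \<and> A \<omega>} = measure W {\<omega>. f (\<omega> (Suc t)) = v \<and> A \<omega>}"
    using X_f by (intro arg_cong[where f = "measure W"]) auto
  also have "\<dots> = (\<Sum>r<N. measure W {\<omega>. f ((fun_upd \<omega> (Suc t) r) (Suc t)) = v \<and> A (fun_upd \<omega> (Suc t) r)}) / real N"
  proof (rule prob_resample[where t = "Suc t"])
    show "determined (Suc t) (\<lambda>\<omega>. f (\<omega> (Suc t)) = v \<and> A \<omega>)"
      by (intro determined_conj determined_mono[OF det]) (auto simp: determined_def)
  qed (simp_all add: letters_Suc N_pos)
  also have "(\<lambda>r. measure W {\<omega>. f ((fun_upd \<omega> (Suc t) r) (Suc t)) = v \<and> A (fun_upd \<omega> (Suc t) r)})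
    = (\<lambda>r. if f r = v then measure W {\<omega>. A \<omega>} else 0)"
    using determined_fun_upd[OF det, of "Suc t"] by auto
  also have "(\<Sum>r<N. if f r = v then measure W {\<omega>. A \<omega>} else 0) / real N
    = real (card ({..<N} \<inter> f -` {v})) / real N * measure W {\<omega>. A \<omega>}"
    by (simp add: sum.If_cases Int_def)
  also have "real (card ({..<N} \<inter> f -` {v})) / real N = pmf (map_pmf f (pmf_of_set {..<N})) v"
    using N_pos by (subst pmf_map, subst measure_pmf_of_set) (auto simp: lessThan_empty_iff)
  also have "map_pmf f (pmf_of_set {..<N}) = kernel 0 c"
    by (simp add: kernel_def f_def[abs_def])
  finally show ?thesis by (simp add: c_def)
qed

lemma kernel_deterministic:
  assumes det: "determined (Suc t) A" and "AE \<omega> in W. A \<omega> \<longrightarrow> X j (Suc t) \<omega> = y"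
    and K: "kernel j c = return_pmf y"
  shows "measure W {\<omega>. X j (Suc t) \<omega> = v \<and> A \<omega>} = pmf (kernel j c) v * measure W {\<omega>. A \<omega>}"
proof -
  have "measure W {\<omega>. X j (Suc t) \<omega> = v \<and> A \<omega>} = measure W {\<omega>. y = v \<and> A \<omega>}"
  proof (rule prob_cong_AE)
    show "AE \<omega> in W. (X j (Suc t) \<omega> = v \<and> A \<omega>) \<longleftrightarrow> (y = v \<and> A \<omega>)"
      using assms(2) by eventually_elim auto
    show "determined (Suc t) (\<lambda>\<omega>. X j (Suc t) \<omega> = v \<and> A \<omega>)"
      by (intro determined_conj det determined_comp[OF determined_X, where g = "\<lambda>y. y = v"])
    show "determined (Suc t) (\<lambda>\<omega>. y = v \<and> A \<omega>)"
      by (rule determined_comp[OF det])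
  qed
  then show ?thesis by (simp add: K indicator_def)
qed

text \<open>
  Given that the flock does not rest, flipping digit \<open>b\<close> of the current letter preserves the past up to
  the turn of walker \<open>2 ^ b\<close>. So this digit is a fair coin given the past, and it decides
  between the two places next to walker \<open>0\<close>.
\<close>
lemma kernel_coin:
  assumes j: "j = 2 ^ b" "j < k" and moving: "\<not> rests j (current_locations k j t x)"
    and A: "\<And>\<omega>. A \<omega> \<longleftrightarrow> same_past k j t (\<lambda>i s. X i s \<omega>) x"
  defines "c \<equiv> current_locations k j t x"
  shows "measure W {\<omega>. X j (Suc t) \<omega> = v \<and> A \<omega>} = pmf (kernel j c) v * measure W {\<omega>. A \<omega>}"
proof -
  interpret prob_space W by (rule prob_space_word_space)
  define f where "f s = nat ((int (c 0) + (if s then int j else - int j)) mod int n)" for s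
  define heads where "heads \<omega> = bit (\<omega> (Suc t)) b" for \<omega> :: "nat \<Rightarrow> nat"
  have jk: "j < 2 ^ e" using j(2) k_le by linarith
  have b: "b < e" using power_less_imp_less_exp[of "2::nat" b e] jk unfolding j(1) by simp
  have det: "determined (Suc t) A" unfolding A by (rule determined_same_past)
  have det_heads: "determined (Suc t) heads" by (simp add: determined_def heads_def)
  have moves: "\<omega> (Suc t) < m" if "A \<omega>" "\<omega> (Suc t) < N" for \<omega>
  proof -
    have "rests j c \<longleftrightarrow> \<not> \<omega> (Suc t) < m"
      using locations[of j t \<omega> x] that(1) j k_pos snd_state[of t \<omega>]
      by (intro rests_iff[OF that(2) _ jk, of "state t \<omega>"]) (auto simp: A c_def)
    then show ?thesis using moving by (simp add: c_def)
  qed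
  have X_f: "X j (Suc t) \<omega> = f (heads \<omega>)" if "A \<omega>" "\<omega> (Suc t) < N" for \<omega>
  proof -
    have "c 0 = pos (state (Suc t) \<omega>) 0"
      using locations[of j t \<omega> x 0] that(1) j by (simp add: A c_def)
    then have "X j (Suc t) \<omega> = nat ((int (c 0) + spin (snd (state (Suc t) \<omega>)) j) mod int n)"
      unfolding X_def by (simp only: pos_anchor[symmetric])
    moreover have "snd (state (Suc t) \<omega>) = \<omega> (Suc t) mod 2 ^ e"
      using moves[OF that] by (simp add: step_def)
    moreover have "bit (\<omega> (Suc t) mod 2 ^ e) b = heads \<omega>"
      using b by (simp add: heads_def bit_simps flip: take_bit_eq_mod)
    ultimately show ?thesis by (simp add: f_def j(1) spin_power)
  qed
  have half: "prob {\<omega>. heads \<omega> = h \<and> A \<omega>} = prob {\<omega>. A \<omega>} / 2" for h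
  proof -
    \<comment> \<open>At a letter \<open>r \<ge> m\<close> the flock would rest, so only the letters below \<open>m\<close> contribute; they are paired by \<open>flip\<close>.\<close>
    have eq: "prob {\<omega>. heads \<omega> = h \<and> A \<omega>} = (\<Sum>r<m. prob {\<omega>. bit r b = h \<and> A (fun_upd \<omega> (Suc t) r)}) / real N" for h
    proof -
      have "prob {\<omega>. heads \<omega> = h \<and> A \<omega>}
        = (\<Sum>r<N. prob {\<omega>. heads (fun_upd \<omega> (Suc t) r) = h \<and> A (fun_upd \<omega> (Suc t) r)}) / real N"
        by (rule prob_resample[where t = "Suc t"])
           (auto simp: letters_Suc N_pos intro: determined_conj det determined_comp[OF det_heads])
      also have "(\<Sum>r<N. prob {\<omega>. heads (fun_upd \<omega> (Suc t) r) = h \<and> A (fun_upd \<omega> (Suc t) r)})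
        = (\<Sum>r<N. prob {\<omega>. bit r b = h \<and> A (fun_upd \<omega> (Suc t) r)})"
        by (simp add: heads_def)
      also have "\<dots> = (\<Sum>r<m. prob {\<omega>. bit r b = h \<and> A (fun_upd \<omega> (Suc t) r)})"
      proof (rule sum.mono_neutral_right)
        show "\<forall>r\<in>{..<N} - {..<m}. prob {\<omega>. bit r b = h \<and> A (fun_upd \<omega> (Suc t) r)} = 0"
        proof
          fix r assume "r \<in> {..<N} - {..<m}"
          then have "\<not> A (fun_upd \<omega> (Suc t) r)" for \<omega> using moves[of "fun_upd \<omega> (Suc t) r"] by auto
          then show "prob {\<omega>. bit r b = h \<and> A (fun_upd \<omega> (Suc t) r)} = 0" by simp
        qed
      qed (use m_le_N in auto)
      finally show ?thesis .
    qed
    have flip: "A (fun_upd \<omega> (Suc t) (xor r (2 ^ b))) = A (fun_upd \<omega> (Suc t) r)" if "r < m" for r \<omega>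
    proof -
      have past: "state s (fun_upd \<omega> (Suc t) r) = state s \<omega>" if "s \<le> t" for s r
        using that by (intro determined_fun_upd[OF determined_state]) simp
      have "X i (Suc t) (fun_upd \<omega> (Suc t) (xor r (2 ^ b))) = X i (Suc t) (fun_upd \<omega> (Suc t) r)"
        if "i < j" for i
        using step_flip_bit[OF b _ \<open>r < m\<close>, of i] that past[of t] by (simp add: X_def j(1))
      moreover have "X i s (fun_upd \<omega> (Suc t) (xor r (2 ^ b))) = X i s (fun_upd \<omega> (Suc t) r)"
        if "s \<le> t" for i s
        using that by (simp add: X_def past)
      ultimately show ?thesis unfolding A past_iff[OF j(2)] by simp
    qed
    have "(2::nat) ^ b < m" using b e_le by (intro power_strict_increasing) auto
    then have less: "xor r (2 ^ b) < m" if "r < m" for r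
      using nat_xor_less[OF that] by blast
    have "(\<Sum>r<m. prob {\<omega>. bit r b = h \<and> A (fun_upd \<omega> (Suc t) r)})
        = (\<Sum>r<m. prob {\<omega>. bit r b = (\<not> h) \<and> A (fun_upd \<omega> (Suc t) r)})"
      by (intro sum.reindex_bij_witness[where i = "\<lambda>r. xor r (2 ^ b)" and j = "\<lambda>r. xor r (2 ^ b)"])
         (auto simp: xor.assoc flip bit_simps less[simplified])
    then have "prob {\<omega>. heads \<omega> = h \<and> A \<omega>} = prob {\<omega>. heads \<omega> = (\<not> h) \<and> A \<omega>}"
      by (simp only: eq)
    moreover have "prob {\<omega>. A \<omega>} = (\<Sum>h'\<in>UNIV. prob {\<omega>. A \<omega> \<and> heads \<omega> = h'})"
      by (rule prob_partition[OF det det_heads]) auto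
    ultimately show ?thesis by (cases h) (simp_all add: UNIV_bool conj_commute)
  qed
  have "prob {\<omega>. X j (Suc t) \<omega> = v \<and> A \<omega>} = prob {\<omega>. f (heads \<omega>) = v \<and> A \<omega>}"
  proof (rule prob_cong_AE)
    show "determined (Suc t) (\<lambda>\<omega>. X j (Suc t) \<omega> = v \<and> A \<omega>)"
      by (intro determined_conj det determined_comp[OF determined_X, where g = "\<lambda>y. y = v"])
    show "determined (Suc t) (\<lambda>\<omega>. f (heads \<omega>) = v \<and> A \<omega>)"
      by (intro determined_conj det determined_comp[OF det_heads, where g = "\<lambda>h. f h = v"])
    show "AE \<omega> in W. (X j (Suc t) \<omega> = v \<and> A \<omega>) \<longleftrightarrow> (f (heads \<omega>) = v \<and> A \<omega>)"
      using AE_letter[of t] by eventually_elim (auto simp: X_f)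
  qed
  also have "\<dots> = (\<Sum>h\<in>UNIV. prob {\<omega>. (f (heads \<omega>) = v \<and> A \<omega>) \<and> heads \<omega> = h})"
    by (intro prob_partition[OF _ det_heads] determined_conj det
        determined_comp[OF det_heads, where g = "\<lambda>h. f h = v"]) auto
  also have "\<dots> = (\<Sum>h\<in>UNIV. if f h = v then prob {\<omega>. A \<omega>} / 2 else 0)"
  proof (rule sum.cong[OF refl])
    fix h
    have "(f (heads \<omega>) = v \<and> A \<omega>) \<and> heads \<omega> = h \<longleftrightarrow> f h = v \<and> heads \<omega> = h \<and> A \<omega>" for \<omega>
      by blast
    then show "prob {\<omega>. (f (heads \<omega>) = v \<and> A \<omega>) \<and> heads \<omega> = h}
      = (if f h = v then prob {\<omega>. A \<omega>} / 2 else 0)"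
      by (cases "f h = v") (simp_all only: half simp_thms if_True if_False, simp)
  qed
  also have "\<dots> = real (card (UNIV \<inter> f -` {v})) / 2 * prob {\<omega>. A \<omega>}"
    by (simp add: sum.If_cases vimage_def)
  also have "real (card (UNIV \<inter> f -` {v})) / 2 = pmf (map_pmf f (pmf_of_set UNIV)) v"
    by (subst pmf_map, subst measure_pmf_of_set) auto
  also have "map_pmf f (pmf_of_set UNIV) = kernel j c"
    using j(1) moving by (auto simp: kernel_def f_def[abs_def] c_def)
  finally show ?thesis .
qed

lemma markovian_X: "markovian W k X"
  unfolding markovian_def
proof (intro exI[of _ kernel] allI impI)
  fix j t x v
  assume jk: "j < k" and pos: "0 < \<P>(\<omega> in W. same_past k j t (\<lambda>i s. X i s \<omega>) x)"
  let ?A = "\<lambda>\<omega>. same_past k j t (\<lambda>i s. X i s \<omega>) x"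
  let ?c = "current_locations k j t x"
  have je: "j < 2 ^ e" using jk k_le by simp
  have "measure W {\<omega>. X j (Suc t) \<omega> = v \<and> ?A \<omega>} = pmf (kernel j ?c) v * measure W {\<omega>. ?A \<omega>}"
  proof (cases "j = 0")
    case True
    then show ?thesis using kernel_first_walker[of ?A t x v] by simp
  next
    case j0: False
    show ?thesis
    proof (cases "rests j ?c")
      case True
      show ?thesis
      proof (rule kernel_deterministic[OF determined_same_past])
        show "kernel j ?c = return_pmf (?c j)" using True j0 by (simp add: kernel_def)
        show "AE \<omega> in W. ?A \<omega> \<longrightarrow> X j (Suc t) \<omega> = ?c j"
          using AE_letter[of t]
        proof eventually_elim
          case (elim \<omega>)
          show ?case
          proof
            assume A: "?A \<omega>"
            have "rests j ?c \<longleftrightarrow> \<not> \<omega> (Suc t) < m"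
              using locations[OF A] jk j0 snd_state[of t \<omega>]
              by (intro rests_iff[OF elim _ je, of "state t \<omega>"]) auto
            then show "X j (Suc t) \<omega> = ?c j"
              using True locations[OF A jk] by (simp add: X_def step_def)
          qed
        qed
      qed
    next
      case moving: False
      show ?thesis
      proof (cases "\<exists>b. j = 2 ^ b")
        case True
        then obtain b where "j = 2 ^ b" ..
        then show ?thesis by (rule kernel_coin[OF _ jk moving refl])
      next
        case False
        let ?b = "floor_log j"
        show ?thesis
        proof (rule kernel_deterministic[OF determined_same_past])
          show "kernel j ?c = return_pmf (nat ((int (?c (2 ^ ?b)) + int (?c (j - 2 ^ ?b)) - int (?c 0)) mod int n))"
            using False moving j0 by (simp add: kernel_def Let_def)
          have "2 ^ ?b \<le> j" using j0 by (simp add: floor_log_exp2_le)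
          then have b: "2 ^ ?b < j" using False by (metis le_neq_implies_less)
          show "AE \<omega> in W. ?A \<omega> \<longrightarrow>
            X j (Suc t) \<omega> = nat ((int (?c (2 ^ ?b)) + int (?c (j - 2 ^ ?b)) - int (?c 0)) mod int n)"
          proof (intro AE_I2 impI)
            fix \<omega> assume A: "?A \<omega>"
            show "X j (Suc t) \<omega> = nat ((int (?c (2 ^ ?b)) + int (?c (j - 2 ^ ?b)) - int (?c 0)) mod int n)"
              unfolding X_def
              by (rule follow_composite[OF j0]) (use locations[OF A] b jk j0 in auto)
          qed
        qed
      qed
    qed
  qed
  then show "\<P>(\<omega> in W. X j (Suc t) \<omega> = v \<bar> ?A \<omega>) = pmf (kernel j ?c) v"
    using pos by (simp add: cond_prob_def)
qed

lemma exists_flock: "exists_min_entropy_markovian_avoidance_coupling V E k"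
  unfolding exists_min_entropy_markovian_avoidance_coupling_def
  using avoidance_coupling_X markovian_X minimum_entropy_X by blast

end

section \<open>Existence for all admissible numbers of vertices and walkers\<close>

theorem theorem6p1:
  fixes d k :: nat
  assumes "1 \<le> k" and "k \<le> 2 ^ d"
  shows "(\<forall>n. n = 2 ^ (d + 1) \<or> n = 2 ^ (d + 1) + 1 \<longrightarrow>
            exists_min_entropy_markovian_avoidance_coupling
              (complete_verts n) (complete_loop_edges n) k)
       \<and> (\<forall>n. n = 2 ^ (d + 1) + 1 \<longrightarrow>
            exists_min_entropy_markovian_avoidance_coupling
              (complete_verts n) (complete_edges n) k)"
proof -
  define e where "e = (LEAST e. k \<le> 2 ^ e)"
  have "e \<le> d" unfolding e_def by (rule Least_le) fact
  moreover have "k \<le> 2 ^ e" unfolding e_def by (rule LeastI) fact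
  moreover have "2 ^ b < k" if "b < e" for b
    using not_less_Least[of b "\<lambda>e. k \<le> 2 ^ e"] that by (simp add: e_def)
  ultimately have flock: "flock d e k n N"
    if "n = 2 ^ (d + 1) \<and> N = n \<or> n = 2 ^ (d + 1) + 1 \<and> (N = n \<or> N = n - 1)" for n N
    using that assms(1) by (simp add: flock_def)
  have loops: "exists_min_entropy_markovian_avoidance_coupling
      (complete_verts n) (complete_loop_edges n) k"
    if "n = 2 ^ (d + 1) \<or> n = 2 ^ (d + 1) + 1" for n
  proof -
    have "flock d e k n n" using that by (intro flock) auto
    from flock.exists_flock[OF this] show ?thesis by (simp add: flock.E_def[OF \<open>flock d e k n n\<close>])
  qed
  have "exists_min_entropy_markovian_avoidance_coupling (complete_verts n) (complete_edges n) k"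
    if "n = 2 ^ (d + 1) + 1" for n
  proof -
    have *: "flock d e k n (n - 1)" using that by (intro flock) auto
    have "n - 1 \<noteq> n" using that by simp
    with flock.exists_flock[OF *] show ?thesis by (simp only: flock.E_def[OF *] if_False)
  qed
  with loops show ?thesis by blast
qed

end
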